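(* The group $C^{\ast}$-algebra $C^{\ast}(\mathbb{F}_{\infty})$ of the free group $\mathbb{F}_\infty$ on a countably infinite number of generators has strongly infinite real rank.
   Context: $C^{\ast}(\mathbb{F}_{\infty})$ is the (full) group $C^{\ast}$-algebra of the discrete group $\mathbb{F}_\infty$. For a unital $C^{\ast}$-algebra $A$, $A_{sa}$ denotes the set of its self-adjoint elements; $\mathbb{N}=\{1,2,\dots\}$. $A$ has weakly infinite real rank if for any sequence $\{x_i : i\in\mathbb{N}\}\subset A_{sa}$ and any $\epsilon>0$ there is a sequence $\{y_i : i\in\mathbb{N}\}\subset A_{sa}$ such that $\|x_i-y_i\|<\epsilon$ for every $i\in\mathbb{N}$ and the element $\sum_{i\in D}y_i^2$ is invertible for some finite set $D\subset\mathbb{N}$ of indices. $A$ has strongly infinite real rank if it does not have weakly infinite real rank. *)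

theory Defs
  imports "HOL-Analysis.Analysis" "HOL-Library.Poly_Mapping"
begin

section \<open>Free groups\<close>

text \<open>
  As in the library, groups that need not be commutative are instances of the class
  \<^class>\<open>group_add\<close>, hence written additively. The free group on \<open>'i\<close> is realised by reduced
  words; the letter \<open>(i, True)\<close> stands for the generator \<open>i\<close> and \<open>(i, False)\<close> for its inverse.
\<close>

fun inv_letter :: "'i \<times> bool \<Rightarrow> 'i \<times> bool" where
  "inv_letter (i, b) = (i, \<not> b)"

definition reduced_word :: "('i \<times> bool) list \<Rightarrow> bool" where
  "reduced_word = successively (\<lambda>a b. b \<noteq> inv_letter a)"

fun push_letter :: "'i \<times> bool \<Rightarrow> ('i \<times> bool) list \<Rightarrow> ('i \<times> bool) list" where
  "push_letter a [] = [a]"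
| "push_letter a (b # w) = (if b = inv_letter a then w else a # b # w)"

lemma inv_letter_inv_letter [simp]: "inv_letter (inv_letter a) = a"
  by (cases a) simp

lemma inv_letter_eq_iff: "inv_letter a = b \<longleftrightarrow> a = inv_letter b"
  by auto

lemma reduced_word_Nil [simp]: "reduced_word []"
  by (simp add: reduced_word_def)

lemma reduced_word_Cons:
  "reduced_word (a # w) \<longleftrightarrow> reduced_word w \<and> (w = [] \<or> hd w \<noteq> inv_letter a)"
  by (auto simp: reduced_word_def successively_Cons)

lemma reduced_push_letter: "reduced_word w \<Longrightarrow> reduced_word (push_letter a w)"
  by (cases w) (auto simp: reduced_word_Cons)

lemma reduced_foldr_push: "reduced_word w \<Longrightarrow> reduced_word (foldr push_letter u w)"
  by (induction u) (auto intro: reduced_push_letter)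

lemma push_inv_push: "reduced_word w \<Longrightarrow> push_letter a (push_letter (inv_letter a) w) = w"
  by (cases w rule: list.exhaust; cases "tl w") (auto simp: reduced_word_Cons)

lemma push_push_inv: "reduced_word w \<Longrightarrow> push_letter (inv_letter a) (push_letter a w) = w"
  using push_inv_push[of w "inv_letter a"] by simp

lemma foldr_push_push_letter:
  assumes "reduced_word w"
  shows "foldr push_letter (push_letter a u) w = push_letter a (foldr push_letter u w)"
proof (cases u)
  case (Cons b v)
  have "reduced_word (foldr push_letter v w)"
    using assms by (rule reduced_foldr_push)
  then show ?thesis using Cons by (auto simp: push_inv_push)
qed simp

lemma foldr_push_assoc:
  assumes "reduced_word w"
  shows "foldr push_letter (foldr push_letter u v) w = foldr push_letter u (foldr push_letter v w)"
  by (induction u) (simp_all add: foldr_push_push_letter assms)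

lemma foldr_push_Nil: "reduced_word u \<Longrightarrow> foldr push_letter u [] = u"
proof (induction u)
  case (Cons a u)
  then show ?case by (cases u) (auto simp: reduced_word_Cons)
qed simp

lemma reduced_inverse_word:
  assumes "reduced_word u"
  shows "reduced_word (rev (map inv_letter u))"
  using assms unfolding reduced_word_def successively_rev successively_map
  by (rule successively_mono) (auto simp: inv_letter_eq_iff)

lemma foldr_push_inverse_word:
  "reduced_word u \<Longrightarrow> foldr push_letter (rev (map inv_letter u)) u = []"
  by (induction u) (auto simp: reduced_word_Cons)

typedef 'i free_group = "{w :: ('i \<times> bool) list. reduced_word w}"
  by (rule exI[of _ "[]"]) simp

setup_lifting type_definition_free_group

instantiation free_group :: (type) group_add
begin

lift_definition zero_free_group :: "'i free_group" is "[]" by simp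

lift_definition plus_free_group :: "'i free_group \<Rightarrow> 'i free_group \<Rightarrow> 'i free_group"
  is "foldr push_letter" by (rule reduced_foldr_push)

lift_definition uminus_free_group :: "'i free_group \<Rightarrow> 'i free_group"
  is "\<lambda>u. rev (map inv_letter u)" by (rule reduced_inverse_word)

definition minus_free_group :: "'i free_group \<Rightarrow> 'i free_group \<Rightarrow> 'i free_group" where
  "minus_free_group u v = u + - v"

instance
proof
  fix a b c :: "'i free_group"
  show "a + b + c = a + (b + c)" by transfer (rule foldr_push_assoc)
  show "0 + a = a" by transfer simp
  show "a + 0 = a" by transfer (rule foldr_push_Nil)
  show "- a + a = 0" by transfer (rule foldr_push_inverse_word)
  show "a + - b = a - b" by (simp add: minus_free_group_def)
qed

end


section \<open>Unital C*-algebras and their real rank\<close>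

class complex_vector = real_vector +
  fixes scaleC :: "complex \<Rightarrow> 'a \<Rightarrow> 'a" (infixr "*\<^sub>C" 75)
  assumes scaleC_add_right: "a *\<^sub>C (x + y) = a *\<^sub>C x + a *\<^sub>C y"
    and scaleC_add_left: "(a + b) *\<^sub>C x = a *\<^sub>C x + b *\<^sub>C x"
    and scaleC_scaleC: "a *\<^sub>C (b *\<^sub>C x) = (a * b) *\<^sub>C x"
    and scaleR_scaleC: "r *\<^sub>R x = complex_of_real r *\<^sub>C x"

text \<open>
  \<^class>\<open>real_normed_algebra_1\<close> includes \<open>0 \<noteq> 1\<close>, so the zero algebra is not an instance.
\<close>

class cstar_algebra = complex_vector + real_normed_algebra_1 + banach +
  fixes star :: "'a \<Rightarrow> 'a"
  assumes mult_scaleC_left: "(a *\<^sub>C x) * y = a *\<^sub>C (x * y)"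
    and mult_scaleC_right: "x * (a *\<^sub>C y) = a *\<^sub>C (x * y)"
    and norm_scaleC: "norm (a *\<^sub>C x) = cmod a * norm x"
    and star_star: "star (star x) = x"
    and star_add: "star (x + y) = star x + star y"
    and star_scaleC: "star (a *\<^sub>C x) = cnj a *\<^sub>C star x"
    and star_mult: "star (x * y) = star y * star x"
    and norm_star_mult: "norm (star x * x) = (norm x)\<^sup>2"

definition selfadjoint :: "'a::cstar_algebra \<Rightarrow> bool" where
  "selfadjoint x \<longleftrightarrow> star x = x"

definition two_sided_invertible :: "'a::monoid_mult \<Rightarrow> bool" where
  "two_sided_invertible x \<longleftrightarrow> (\<exists>z. z * x = 1 \<and> x * z = 1)"

definition weakly_infinite_real_rank :: "'a::cstar_algebra itself \<Rightarrow> bool" where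
  "weakly_infinite_real_rank A \<longleftrightarrow>
    (\<forall>(x :: nat \<Rightarrow> 'a) \<epsilon>. (\<forall>i. selfadjoint (x i)) \<and> \<epsilon> > 0 \<longrightarrow>
      (\<exists>y :: nat \<Rightarrow> 'a. (\<forall>i. selfadjoint (y i)) \<and> (\<forall>i. norm (x i - y i) < \<epsilon>) \<and>
        (\<exists>D. finite D \<and> two_sided_invertible (\<Sum>i\<in>D. (y i)\<^sup>2))))"

definition strongly_infinite_real_rank :: "'a::cstar_algebra itself \<Rightarrow> bool" where
  "strongly_infinite_real_rank A \<longleftrightarrow> \<not> weakly_infinite_real_rank A"


section \<open>The Hilbert space of square-summable families\<close>

typedef 'x ell2 = "{f :: 'x \<Rightarrow> complex. (\<lambda>i. (cmod (f i))\<^sup>2) summable_on UNIV}"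
  by (rule exI[of _ "\<lambda>_. 0"]) simp

setup_lifting type_definition_ell2

lemma ell2_add_summable:
  fixes f g :: "'x \<Rightarrow> complex"
  assumes "(\<lambda>i. (cmod (f i))\<^sup>2) summable_on UNIV" "(\<lambda>i. (cmod (g i))\<^sup>2) summable_on UNIV"
  shows "(\<lambda>i. (cmod (f i + g i))\<^sup>2) summable_on UNIV"
proof (rule summable_on_comparison_test)
  show "(\<lambda>i. 2 * (cmod (f i))\<^sup>2 + 2 * (cmod (g i))\<^sup>2) summable_on UNIV"
    by (intro summable_on_add summable_on_cmult_right assms)
  fix i
  have "(cmod (f i + g i))\<^sup>2 \<le> (cmod (f i) + cmod (g i))\<^sup>2"
    by (intro power_mono norm_triangle_ineq) auto
  also have "\<dots> \<le> 2 * (cmod (f i))\<^sup>2 + 2 * (cmod (g i))\<^sup>2"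
    using sum_squares_bound[of "cmod (f i)" "cmod (g i)"] by (simp add: power2_sum)
  finally show "(cmod (f i + g i))\<^sup>2 \<le> 2 * (cmod (f i))\<^sup>2 + 2 * (cmod (g i))\<^sup>2" .
qed auto

lemma ell2_cmult_summable:
  fixes f :: "'x \<Rightarrow> complex"
  assumes "(\<lambda>i. (cmod (f i))\<^sup>2) summable_on UNIV"
  shows "(\<lambda>i. (cmod (c * f i))\<^sup>2) summable_on UNIV"
  using summable_on_cmult_right[OF assms, of "(cmod c)\<^sup>2"]
  by (simp add: norm_mult power_mult_distrib)

lemma ell2_inner_summable:
  fixes f g :: "'x \<Rightarrow> complex"
  assumes "(\<lambda>i. (cmod (f i))\<^sup>2) summable_on UNIV" "(\<lambda>i. (cmod (g i))\<^sup>2) summable_on UNIV"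
  shows "(\<lambda>i. f i \<bullet> g i) summable_on UNIV"
proof -
  have "(\<lambda>i. norm (f i \<bullet> g i)) summable_on UNIV"
  proof (rule summable_on_comparison_test)
    show "(\<lambda>i. (cmod (f i))\<^sup>2 + (cmod (g i))\<^sup>2) summable_on UNIV"
      by (intro summable_on_add assms)
    fix i
    have "norm (f i \<bullet> g i) \<le> cmod (f i) * cmod (g i)"
      by (simp add: Cauchy_Schwarz_ineq2)
    also have "\<dots> \<le> (cmod (f i))\<^sup>2 + (cmod (g i))\<^sup>2"
      using sum_squares_bound[of "cmod (f i)" "cmod (g i)"]
        mult_nonneg_nonneg[of "cmod (f i)" "cmod (g i)"] by (simp del: mult_nonneg_nonneg)
    finally show "norm (f i \<bullet> g i) \<le> (cmod (f i))\<^sup>2 + (cmod (g i))\<^sup>2" .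
  qed auto
  then show ?thesis by (rule abs_summable_summable)
qed

instantiation ell2 :: (type) complex_vector
begin

lift_definition zero_ell2 :: "'x ell2" is "\<lambda>_. 0" by simp
lift_definition plus_ell2 :: "'x ell2 \<Rightarrow> 'x ell2 \<Rightarrow> 'x ell2" is "\<lambda>f g i. f i + g i"
  by (rule ell2_add_summable)
lift_definition uminus_ell2 :: "'x ell2 \<Rightarrow> 'x ell2" is "\<lambda>f i. - f i" by simp
lift_definition minus_ell2 :: "'x ell2 \<Rightarrow> 'x ell2 \<Rightarrow> 'x ell2" is "\<lambda>f g i. f i - g i"
  using ell2_add_summable[of _ "\<lambda>i. - _ i"] by simp
lift_definition scaleC_ell2 :: "complex \<Rightarrow> 'x ell2 \<Rightarrow> 'x ell2" is "\<lambda>c f i. c * f i"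
  by (rule ell2_cmult_summable)
definition scaleR_ell2 :: "real \<Rightarrow> 'x ell2 \<Rightarrow> 'x ell2" where
  "scaleR_ell2 r x = complex_of_real r *\<^sub>C x"

instance
proof
  fix x y z :: "'x ell2" and a b :: complex and r s :: real
  show "x + y + z = x + (y + z)" by transfer (simp add: add.assoc)
  show "x + y = y + x" by transfer (simp add: add.commute)
  show "0 + x = x" by transfer simp
  show "- x + x = 0" by transfer simp
  show "x - y = x + - y" by transfer simp
  show "a *\<^sub>C (x + y) = a *\<^sub>C x + a *\<^sub>C y" by transfer (simp add: algebra_simps)
  show "(a + b) *\<^sub>C x = a *\<^sub>C x + b *\<^sub>C x" by transfer (simp add: algebra_simps)
  show "a *\<^sub>C b *\<^sub>C x = (a * b) *\<^sub>C x" by transfer (simp add: algebra_simps)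
  show "r *\<^sub>R x = complex_of_real r *\<^sub>C x" by (simp add: scaleR_ell2_def)
  show "r *\<^sub>R (x + y) = r *\<^sub>R x + r *\<^sub>R y"
    unfolding scaleR_ell2_def by transfer (simp add: algebra_simps)
  show "(r + s) *\<^sub>R x = r *\<^sub>R x + s *\<^sub>R x"
    unfolding scaleR_ell2_def by transfer (simp add: algebra_simps)
  show "r *\<^sub>R s *\<^sub>R x = (r * s) *\<^sub>R x"
    unfolding scaleR_ell2_def by transfer (simp add: algebra_simps)
  show "1 *\<^sub>R x = x" unfolding scaleR_ell2_def by transfer simp
qed

end

text \<open>
  The class \<^class>\<open>real_inner\<close> records the real part of the complex inner product; the norm it
  induces is the usual one, \<open>(\<Sum>\<^sub>\<infinity>i. |x\<^sub>i|\<^sup>2)\<^sup>\<onehalf>\<close>.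
\<close>

instantiation ell2 :: (type) real_inner
begin

lift_definition inner_ell2 :: "'x ell2 \<Rightarrow> 'x ell2 \<Rightarrow> real"
  is "\<lambda>f g. \<Sum>\<^sub>\<infinity>i. f i \<bullet> g i" .
definition norm_ell2 :: "'x ell2 \<Rightarrow> real" where "norm_ell2 x = sqrt (x \<bullet> x)"
definition dist_ell2 :: "'x ell2 \<Rightarrow> 'x ell2 \<Rightarrow> real" where "dist_ell2 x y = norm (x - y)"
definition sgn_ell2 :: "'x ell2 \<Rightarrow> 'x ell2" where "sgn_ell2 x = x /\<^sub>R norm x"
definition uniformity_ell2 :: "('x ell2 \<times> 'x ell2) filter" where
  "uniformity_ell2 = (INF e\<in>{0 <..}. principal {(x, y). dist x y < e})"
definition open_ell2 :: "'x ell2 set \<Rightarrow> bool" where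
  "open_ell2 U \<longleftrightarrow> (\<forall>x\<in>U. eventually (\<lambda>(x', y). x' = x \<longrightarrow> y \<in> U) uniformity)"

instance
proof
  fix x y z :: "'x ell2" and r :: real and U :: "'x ell2 set"
  show "dist x y = norm (x - y)" by (simp add: dist_ell2_def)
  show "sgn x = x /\<^sub>R norm x" by (simp add: sgn_ell2_def)
  show "(uniformity :: ('x ell2 \<times> 'x ell2) filter) =
      (INF e\<in>{0 <..}. principal {(x, y). dist x y < e})" by (rule uniformity_ell2_def)
  show "open U \<longleftrightarrow> (\<forall>x\<in>U. eventually (\<lambda>(x', y). x' = x \<longrightarrow> y \<in> U) uniformity)"
    by (rule open_ell2_def)
  show "norm x = sqrt (x \<bullet> x)" by (rule norm_ell2_def)
  show "x \<bullet> y = y \<bullet> x" by transfer (simp add: inner_commute)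
  show "(x + y) \<bullet> z = x \<bullet> z + y \<bullet> z"
    by transfer (simp add: inner_add_left infsum_add ell2_inner_summable)
  show "(r *\<^sub>R x) \<bullet> y = r * (x \<bullet> y)"
    unfolding scaleR_ell2_def
    by transfer (simp flip: scaleR_conv_of_real add: infsum_cmult_right')
  show "0 \<le> x \<bullet> x" by transfer (simp add: infsum_nonneg)
  show "x \<bullet> x = 0 \<longleftrightarrow> x = 0"
  proof transfer
    fix f :: "'x \<Rightarrow> complex"
    assume f: "(\<lambda>i. (cmod (f i))\<^sup>2) summable_on UNIV"
    show "(\<Sum>\<^sub>\<infinity>i. f i \<bullet> f i) = 0 \<longleftrightarrow> f = (\<lambda>_. 0)"
    proof
      assume 0: "(\<Sum>\<^sub>\<infinity>i. f i \<bullet> f i) = 0"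
      have "f i \<bullet> f i = 0" for i
        by (rule nonneg_infsum_le_0D[of _ UNIV])
           (use 0 f in \<open>auto intro: ell2_inner_summable\<close>)
      then show "f = (\<lambda>_. 0)" by auto
    qed auto
  qed
qed

end

lemma inner_scaleC_ell2: "(a *\<^sub>C x) \<bullet> (y :: 'x ell2) = x \<bullet> (cnj a *\<^sub>C y)"
  by transfer (simp add: inner_complex_def algebra_simps)

lemma norm_scaleC_ell2: "norm (a *\<^sub>C (x :: 'x ell2)) = cmod a * norm x"
proof -
  have "(a *\<^sub>C x) \<bullet> (a *\<^sub>C x) = x \<bullet> (complex_of_real ((cmod a)\<^sup>2) *\<^sub>C x)"
    unfolding inner_scaleC_ell2 scaleC_scaleC by (simp add: complex_norm_square mult.commute del: of_real_power)
  also have "\<dots> = (cmod a)\<^sup>2 * (x \<bullet> x)"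
    unfolding scaleR_scaleC[symmetric] by (rule inner_scaleR_right)
  finally have "(a *\<^sub>C x) \<bullet> (a *\<^sub>C x) = (cmod a)\<^sup>2 * (x \<bullet> x)" .
  then show ?thesis
    by (simp add: norm_eq_sqrt_inner real_sqrt_mult)
qed


section \<open>The full group C*-algebra of a discrete group\<close>

lemma scaleC_one [simp]: "1 *\<^sub>C (x :: 'a::complex_vector) = x"
  using scaleR_scaleC[of 1 x] by simp

lemma scaleC_zero_left [simp]: "0 *\<^sub>C (x :: 'a::complex_vector) = 0"
  using scaleR_scaleC[of 0 x] by simp

lemma scaleC_zero_right [simp]: "a *\<^sub>C (0 :: 'a::complex_vector) = 0"
  using scaleC_add_right[of a 0 "0 :: 'a"] by simp

lemma scaleC_sum_right: "a *\<^sub>C (\<Sum>i\<in>A. f i) = (\<Sum>i\<in>A. a *\<^sub>C (f i :: 'a::complex_vector))"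
  by (induction A rule: infinite_finite_induct) (auto simp: scaleC_add_right)

definition unitary_op :: "('x ell2 \<Rightarrow> 'x ell2) \<Rightarrow> bool" where
  "unitary_op U \<longleftrightarrow> (\<forall>x y. U (x + y) = U x + U y) \<and> (\<forall>c x. U (c *\<^sub>C x) = c *\<^sub>C U x) \<and>
     (\<forall>x. norm (U x) = norm x) \<and> surj U"

definition unitary_rep :: "('g::group_add \<Rightarrow> 'x ell2 \<Rightarrow> 'x ell2) \<Rightarrow> bool" where
  "unitary_rep \<pi> \<longleftrightarrow> (\<forall>g. unitary_op (\<pi> g)) \<and> \<pi> 0 = id \<and> (\<forall>g h. \<pi> (g + h) = \<pi> g \<circ> \<pi> h)"

text \<open>
  For a group \<open>'g\<close>, the type \<open>'g \<Rightarrow>\<^sub>0 complex\<close> of finitely supported functions with its library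
  multiplication (convolution) is the complex group algebra.
\<close>

definition algebra_rep ::
    "('g::group_add \<Rightarrow> 'x ell2 \<Rightarrow> 'x ell2) \<Rightarrow> ('g \<Rightarrow>\<^sub>0 complex) \<Rightarrow> 'x ell2 \<Rightarrow> 'x ell2" where
  "algebra_rep \<pi> f \<xi> = (\<Sum>g\<in>Poly_Mapping.keys f. Poly_Mapping.lookup f g *\<^sub>C \<pi> g \<xi>)"

lift_definition galg_scale :: "complex \<Rightarrow> ('g::group_add \<Rightarrow>\<^sub>0 complex) \<Rightarrow> 'g \<Rightarrow>\<^sub>0 complex"
  is "\<lambda>c f g. c * f g"
  by (erule rev_finite_subset) auto

lift_definition galg_star :: "('g::group_add \<Rightarrow>\<^sub>0 complex) \<Rightarrow> 'g \<Rightarrow>\<^sub>0 complex"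
  is "\<lambda>f g. cnj (f (- g))"
proof -
  fix f :: "'g \<Rightarrow> complex"
  assume "finite {g. f g \<noteq> 0}"
  moreover have "{g. cnj (f (- g)) \<noteq> 0} \<subseteq> uminus ` {g. f g \<noteq> 0}"
    by (auto simp: image_iff intro!: exI[of _ "- _"])
  ultimately show "finite {g. cnj (f (- g)) \<noteq> 0}"
    by (rule finite_surj)
qed

text \<open>
  The maximal norm on the group algebra: the supremum of the operator norms over all unitary
  representations. To quantify over representations inside the logic, they act on one fixed Hilbert
  space, \<open>\<ell>\<^sup>2('g \<times> \<nat>)\<close>. This loses nothing: the supremum over all representations is the supremum over
  the cyclic ones, a cyclic representation has Hilbert dimension at most \<open>|'g \<times> \<nat>|\<close>, and a
  \<open>|'g \<times> \<nat>|\<close>-fold multiple of it, which has the same operator norms, is then (up to unitary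
  equivalence) a representation on \<open>\<ell>\<^sup>2('g \<times> \<nat>)\<close>. For countable \<open>'g\<close> this is the separable
  infinite-dimensional Hilbert space.
\<close>

definition full_norm :: "('g::group_add \<Rightarrow>\<^sub>0 complex) \<Rightarrow> real" where
  "full_norm f =
    (SUP \<pi>\<in>{\<pi> :: 'g \<Rightarrow> ('g \<times> nat) ell2 \<Rightarrow> ('g \<times> nat) ell2. unitary_rep \<pi>}. onorm (algebra_rep \<pi> f))"

lemma lookup_galg_scale [simp]:
  "Poly_Mapping.lookup (galg_scale c f) g = c * Poly_Mapping.lookup f g"
  by transfer simp

lemma lookup_galg_star [simp]:
  "Poly_Mapping.lookup (galg_star f) g = cnj (Poly_Mapping.lookup f (- g))"
  by transfer simp

lemma galg_decompose:
  "(f :: 'g \<Rightarrow>\<^sub>0 complex) =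
     (\<Sum>g\<in>Poly_Mapping.keys f. Poly_Mapping.single g (Poly_Mapping.lookup f g))"
proof (rule poly_mapping_eqI)
  fix k
  have "(\<Sum>g\<in>Poly_Mapping.keys f. Poly_Mapping.lookup f g when g = k) = Poly_Mapping.lookup f k"
    by (simp add: when_def sum.delta in_keys_iff)
  then show "Poly_Mapping.lookup f k = Poly_Mapping.lookup
      (\<Sum>g\<in>Poly_Mapping.keys f. Poly_Mapping.single g (Poly_Mapping.lookup f g)) k"
    by (simp add: lookup_sum lookup_single)
qed

lemma galg_induct [case_names zero add single]:
  fixes f :: "'g \<Rightarrow>\<^sub>0 complex"
  assumes "P 0" "\<And>f h. P f \<Longrightarrow> P h \<Longrightarrow> P (f + h)" "\<And>g a. P (Poly_Mapping.single g a)"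
  shows "P f"
proof -
  have "P (\<Sum>g\<in>A. Poly_Mapping.single g (Poly_Mapping.lookup f g))" for A
    by (induction A rule: infinite_finite_induct) (auto intro: assms)
  then show ?thesis by (subst galg_decompose)
qed

lemma galg_scale_add: "galg_scale c (f + h) = galg_scale c f + galg_scale c h"
  by (rule poly_mapping_eqI) (simp add: lookup_add algebra_simps)

lemma galg_scale_diff: "galg_scale c (f - h) = galg_scale c f - galg_scale c h"
  by (rule poly_mapping_eqI) (simp add: lookup_minus algebra_simps)

lemma galg_scale_add_left: "galg_scale (a + b) f = galg_scale a f + galg_scale b f"
  by (rule poly_mapping_eqI) (simp add: lookup_add algebra_simps)

lemma galg_scale_scale: "galg_scale a (galg_scale b f) = galg_scale (a * b) f"
  by (rule poly_mapping_eqI) (simp add: algebra_simps)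

lemma galg_scale_one [simp]: "galg_scale 1 f = f"
  by (rule poly_mapping_eqI) simp

lemma galg_scale_minus_one: "galg_scale (- 1) f = - f"
  by (rule poly_mapping_eqI) simp

lemma galg_scale_0 [simp]: "galg_scale c 0 = 0"
  by (rule poly_mapping_eqI) simp

lemma galg_scale_single:
  "galg_scale c (Poly_Mapping.single g a) = Poly_Mapping.single g (c * a)"
  by (rule poly_mapping_eqI) (simp add: lookup_single when_def)

lemma galg_star_add: "galg_star (f + h) = galg_star f + galg_star h"
  by (rule poly_mapping_eqI) (simp add: lookup_add)

lemma galg_star_diff: "galg_star (f - h) = galg_star f - galg_star h"
  by (rule poly_mapping_eqI) (simp add: lookup_minus)

lemma galg_star_0 [simp]: "galg_star 0 = 0"
  by (rule poly_mapping_eqI) simp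

lemma galg_star_star [simp]: "galg_star (galg_star f) = f"
  by (rule poly_mapping_eqI) simp

lemma galg_star_scale: "galg_star (galg_scale c f) = galg_scale (cnj c) (galg_star f)"
  by (rule poly_mapping_eqI) simp

lemma galg_star_single: "galg_star (Poly_Mapping.single g a) = Poly_Mapping.single (- g) (cnj a)"
  by (rule poly_mapping_eqI) (auto simp: lookup_single when_def)

lemma galg_scale_mult_left: "galg_scale c f * h = galg_scale c (f * h)"
proof (induction f rule: galg_induct)
  case (single g a)
  show ?case
    by (induction h rule: galg_induct)
       (simp_all add: galg_scale_single mult_single galg_scale_add distrib_left mult.assoc)
qed (simp_all add: galg_scale_add distrib_right)

lemma galg_scale_mult_right: "f * galg_scale c h = galg_scale c (f * h)"
proof (induction f rule: galg_induct)
  case (single g a)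
  show ?case
    by (induction h rule: galg_induct)
       (simp_all add: galg_scale_single mult_single galg_scale_add distrib_left mult_ac)
qed (simp_all add: galg_scale_add distrib_right)

lemma galg_star_mult: "galg_star (f * h) = galg_star h * galg_star f"
proof (induction f rule: galg_induct)
  case (single g a)
  show ?case
    by (induction h rule: galg_induct)
       (simp_all add: galg_star_single mult_single galg_star_add distrib_left distrib_right
          minus_add mult.commute)
qed (simp_all add: galg_star_add distrib_left distrib_right)

lemma algebra_rep_superset:
  assumes "finite A" "Poly_Mapping.keys f \<subseteq> A"
  shows "algebra_rep \<pi> f \<xi> = (\<Sum>g\<in>A. Poly_Mapping.lookup f g *\<^sub>C \<pi> g \<xi>)"
  unfolding algebra_rep_def using assms
  by (intro sum.mono_neutral_left) (auto simp: in_keys_iff)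

lemma algebra_rep_zero [simp]: "algebra_rep \<pi> 0 \<xi> = 0"
  by (simp add: algebra_rep_def)

lemma algebra_rep_add: "algebra_rep \<pi> (f + h) \<xi> = algebra_rep \<pi> f \<xi> + algebra_rep \<pi> h \<xi>"
proof -
  let ?A = "Poly_Mapping.keys f \<union> Poly_Mapping.keys h"
  have "Poly_Mapping.keys (f + h) \<subseteq> ?A" by (rule keys_add)
  then show ?thesis
    by (simp add: algebra_rep_superset[of ?A] lookup_add scaleC_add_left sum.distrib)
qed

lemma algebra_rep_scale: "algebra_rep \<pi> (galg_scale c f) \<xi> = c *\<^sub>C algebra_rep \<pi> f \<xi>"
proof -
  have "Poly_Mapping.keys (galg_scale c f) \<subseteq> Poly_Mapping.keys f"
    by (auto simp: in_keys_iff)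
  then show ?thesis
    by (simp add: algebra_rep_superset[of "Poly_Mapping.keys f"] scaleC_sum_right scaleC_scaleC)
qed

lemma algebra_rep_single: "algebra_rep \<pi> (Poly_Mapping.single g a) \<xi> = a *\<^sub>C \<pi> g \<xi>"
  by (simp add: algebra_rep_superset[of "{g}"])

context
  fixes \<pi> :: "'g::group_add \<Rightarrow> 'x ell2 \<Rightarrow> 'x ell2"
  assumes \<pi>: "unitary_rep \<pi>"
begin

lemma rep_add: "\<pi> g (x + y) = \<pi> g x + \<pi> g y"
  and rep_scaleC: "\<pi> g (c *\<^sub>C x) = c *\<^sub>C \<pi> g x"
  and rep_norm: "norm (\<pi> g x) = norm x"
  and rep_mult: "\<pi> (g + h) x = \<pi> g (\<pi> h x)"
  and rep_one: "\<pi> 0 x = x"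
  using \<pi> by (auto simp: unitary_rep_def unitary_op_def)

lemma rep_adjoint: "\<pi> g x \<bullet> y = x \<bullet> \<pi> (- g) y"
proof -
  have "\<pi> g x \<bullet> \<pi> g z = x \<bullet> z" for z
    unfolding dot_norm by (simp flip: rep_add add: rep_norm)
  moreover have "\<pi> g (\<pi> (- g) y) = y"
    by (simp flip: rep_mult add: rep_one)
  ultimately show ?thesis by metis
qed

lemma algebra_rep_vec_add: "algebra_rep \<pi> f (x + y) = algebra_rep \<pi> f x + algebra_rep \<pi> f y"
  by (simp add: algebra_rep_def rep_add scaleC_add_right sum.distrib)

lemma algebra_rep_vec_scaleC: "algebra_rep \<pi> f (c *\<^sub>C x) = c *\<^sub>C algebra_rep \<pi> f x"
  by (simp add: algebra_rep_def rep_scaleC scaleC_sum_right scaleC_scaleC mult.commute)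

lemma norm_algebra_rep_le:
  "norm (algebra_rep \<pi> f x) \<le> (\<Sum>g\<in>Poly_Mapping.keys f. cmod (Poly_Mapping.lookup f g)) * norm x"
  unfolding algebra_rep_def sum_distrib_right
  by (rule sum_norm_le) (simp add: norm_scaleC_ell2 rep_norm)

lemma bounded_linear_algebra_rep: "bounded_linear (algebra_rep \<pi> f)"
  by (rule bounded_linear_intro[where K =
        "\<Sum>g\<in>Poly_Mapping.keys f. cmod (Poly_Mapping.lookup f g)"])
     (use norm_algebra_rep_le in
       \<open>auto simp: algebra_rep_vec_add algebra_rep_vec_scaleC scaleR_scaleC mult.commute\<close>)

lemma algebra_rep_mult: "algebra_rep \<pi> (f * h) x = algebra_rep \<pi> f (algebra_rep \<pi> h x)"
proof (induction f rule: galg_induct)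
  case (single g a)
  show ?case
    by (induction h rule: galg_induct)
       (simp_all add: algebra_rep_single mult_single algebra_rep_add distrib_left rep_add rep_scaleC
          rep_mult scaleC_scaleC scaleC_add_right rep_scaleC[of _ 0 0, simplified])
qed (simp_all add: algebra_rep_add distrib_right)

lemma algebra_rep_one: "algebra_rep \<pi> 1 x = x"
  by (simp add: algebra_rep_single rep_one flip: single_one)

lemma algebra_rep_adjoint: "algebra_rep \<pi> f x \<bullet> y = x \<bullet> algebra_rep \<pi> (galg_star f) y"
  by (induction f rule: galg_induct)
     (simp_all add: algebra_rep_add algebra_rep_single galg_star_add galg_star_single
       inner_add_left inner_add_right inner_scaleC_ell2 rep_adjoint rep_scaleC)

end

lemma unitary_rep_trivial: "unitary_rep (\<lambda>_. id)"
  by (auto simp: unitary_rep_def unitary_op_def)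

lemma algebra_rep_le_full_norm:
  fixes \<pi> :: "'g::group_add \<Rightarrow> ('g \<times> nat) ell2 \<Rightarrow> ('g \<times> nat) ell2"
  assumes "unitary_rep \<pi>"
  shows "norm (algebra_rep \<pi> f x) \<le> full_norm f * norm x"
proof -
  let ?C = "\<Sum>g\<in>Poly_Mapping.keys f. cmod (Poly_Mapping.lookup f g)"
  have "onorm (algebra_rep \<rho> f) \<le> ?C" if "unitary_rep \<rho>"
    for \<rho> :: "'g \<Rightarrow> ('g \<times> nat) ell2 \<Rightarrow> ('g \<times> nat) ell2"
    by (rule onorm_bound) (use norm_algebra_rep_le[OF that] in \<open>auto intro: sum_nonneg\<close>)
  then have "onorm (algebra_rep \<pi> f) \<le> full_norm f"
    unfolding full_norm_def using assms
    by (intro cSUP_upper) (auto intro!: bdd_aboveI2[of _ _ ?C])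
  then show ?thesis
    using onorm[OF bounded_linear_algebra_rep[OF assms], of f x]
    by (meson mult_right_mono norm_ge_zero order_trans)
qed

lemma full_norm_least:
  fixes f :: "'g::group_add \<Rightarrow>\<^sub>0 complex"
  assumes "\<And>(\<pi> :: 'g \<Rightarrow> ('g \<times> nat) ell2 \<Rightarrow> ('g \<times> nat) ell2) x.
      unitary_rep \<pi> \<Longrightarrow> norm (algebra_rep \<pi> f x) \<le> b * norm x" and "0 \<le> b"
  shows "full_norm f \<le> b"
  unfolding full_norm_def
  by (rule cSUP_least) (use assms unitary_rep_trivial in \<open>auto intro!: onorm_bound\<close>)

lemma ex_ell2_nonzero: "\<exists>x :: 'x ell2. x \<noteq> 0"
proof -
  obtain j :: 'x where True by simp
  have "(\<lambda>i. if i = j then 1 else 0 :: complex) \<in> {f. (\<lambda>i. (cmod (f i))\<^sup>2) summable_on UNIV}"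
    by (auto intro!: finite_nonzero_values_imp_summable_on)
  then show ?thesis
    by (metis (mono_tags, lifting) Abs_ell2_inverse zero_ell2.rep_eq zero_neq_one)
qed

lemma full_norm_nonneg: "0 \<le> full_norm f"
proof -
  obtain x :: "('a \<times> nat) ell2" where "x \<noteq> 0" using ex_ell2_nonzero by blast
  then show ?thesis
    using algebra_rep_le_full_norm[OF unitary_rep_trivial, of f x]
    by (metis linorder_not_le norm_ge_zero order_trans mult_less_0_iff norm_le_zero_iff)
qed

lemma full_norm_one [simp]: "full_norm (1 :: 'g::group_add \<Rightarrow>\<^sub>0 complex) = 1"
proof (rule antisym)
  show "full_norm (1 :: 'g \<Rightarrow>\<^sub>0 complex) \<le> 1"
    by (rule full_norm_least) (simp_all add: algebra_rep_one)
  obtain x :: "('g \<times> nat) ell2" where "x \<noteq> 0" using ex_ell2_nonzero by blast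
  then show "1 \<le> full_norm (1 :: 'g \<Rightarrow>\<^sub>0 complex)"
    using algebra_rep_le_full_norm[OF unitary_rep_trivial, of 1 x]
    by (simp add: algebra_rep_one[OF unitary_rep_trivial])
qed

lemma full_norm_triangle: "full_norm (f + h) \<le> full_norm f + full_norm h"
  by (rule full_norm_least)
     (auto simp: algebra_rep_add distrib_right full_norm_nonneg
        intro!: norm_triangle_mono algebra_rep_le_full_norm)

lemma full_norm_mult: "full_norm (f * h) \<le> full_norm f * full_norm h"
proof (rule full_norm_least)
  fix \<pi> :: "'a \<Rightarrow> ('a \<times> nat) ell2 \<Rightarrow> ('a \<times> nat) ell2" and x
  assume \<pi>: "unitary_rep \<pi>"
  have "norm (algebra_rep \<pi> (f * h) x) \<le> full_norm f * norm (algebra_rep \<pi> h x)"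
    by (simp add: algebra_rep_mult \<pi> algebra_rep_le_full_norm)
  also have "\<dots> \<le> full_norm f * (full_norm h * norm x)"
    by (intro mult_left_mono algebra_rep_le_full_norm \<pi> full_norm_nonneg)
  finally show "norm (algebra_rep \<pi> (f * h) x) \<le> full_norm f * full_norm h * norm x"
    by (simp add: mult.assoc)
qed (simp add: full_norm_nonneg)

lemma full_norm_scale_le: "full_norm (galg_scale c f) \<le> cmod c * full_norm f"
  by (rule full_norm_least)
     (auto simp: algebra_rep_scale norm_scaleC_ell2 full_norm_nonneg mult.assoc
        intro!: mult_left_mono algebra_rep_le_full_norm)

lemma full_norm_zero [simp]: "full_norm (0 :: 'g::group_add \<Rightarrow>\<^sub>0 complex) = 0"
  using full_norm_scale_le[of 0 "0 :: 'g \<Rightarrow>\<^sub>0 complex"]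
    full_norm_nonneg[of "0 :: 'g \<Rightarrow>\<^sub>0 complex"] by simp

lemma full_norm_scale: "full_norm (galg_scale c f) = cmod c * full_norm f"
proof (cases "c = 0")
  case True
  then show ?thesis
    using full_norm_scale_le[of 0 f] full_norm_nonneg[of "galg_scale 0 f"] by simp
next
  case False
  have "full_norm f = full_norm (galg_scale (inverse c) (galg_scale c f))"
    using False by (simp add: galg_scale_scale)
  also have "\<dots> \<le> cmod (inverse c) * full_norm (galg_scale c f)"
    by (rule full_norm_scale_le)
  finally have "cmod c * full_norm f \<le> full_norm (galg_scale c f)"
    using False by (simp add: norm_inverse pos_le_divide_eq mult.commute flip: divide_inverse_commute)
  then show ?thesis using full_norm_scale_le[of c f] by simp
qed

lemma full_norm_uminus: "full_norm (- f) = full_norm f"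
  using full_norm_scale[of "- 1" f] by (simp add: galg_scale_minus_one)

lemma full_norm_minus_commute: "full_norm (f - h) = full_norm (h - f)"
  using full_norm_uminus[of "f - h"] by simp

lemma full_norm_triangle_diff: "full_norm (f - h) \<le> full_norm (f - k) + full_norm (k - h)"
  using full_norm_triangle[of "f - k" "k - h"] by simp

lemma full_norm_diff_le: "\<bar>full_norm f - full_norm h\<bar> \<le> full_norm (f - h)"
  using full_norm_triangle[of "f - h" h] full_norm_triangle[of "h - f" f]
  by (simp add: full_norm_minus_commute[of h f])

lemma full_norm_star_mult_ge: "(full_norm f)\<^sup>2 \<le> full_norm (galg_star f * f)"
proof -
  have "full_norm f \<le> sqrt (full_norm (galg_star f * f))"
  proof (rule full_norm_least)
    fix \<pi> :: "'a \<Rightarrow> ('a \<times> nat) ell2 \<Rightarrow> ('a \<times> nat) ell2" and x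
    assume \<pi>: "unitary_rep \<pi>"
    have "(norm (algebra_rep \<pi> f x))\<^sup>2 = x \<bullet> algebra_rep \<pi> (galg_star f * f) x"
      by (simp add: power2_norm_eq_inner algebra_rep_adjoint \<pi> algebra_rep_mult)
    also have "\<dots> \<le> norm x * norm (algebra_rep \<pi> (galg_star f * f) x)"
      by (rule norm_cauchy_schwarz)
    also have "\<dots> \<le> norm x * (full_norm (galg_star f * f) * norm x)"
      by (intro mult_left_mono algebra_rep_le_full_norm \<pi> norm_ge_zero)
    also have "\<dots> = (sqrt (full_norm (galg_star f * f)) * norm x)\<^sup>2"
      by (simp add: power_mult_distrib full_norm_nonneg) (simp add: power2_eq_square)
    finally show "norm (algebra_rep \<pi> f x) \<le> sqrt (full_norm (galg_star f * f)) * norm x"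
      by (rule power2_le_imp_le) (simp add: full_norm_nonneg)
  qed (simp add: full_norm_nonneg)
  then show ?thesis
    by (metis full_norm_nonneg power_mono real_sqrt_pow2)
qed

lemma full_norm_star: "full_norm (galg_star f) = full_norm f"
proof -
  have *: "full_norm f \<le> full_norm (galg_star f)" for f :: "'a \<Rightarrow>\<^sub>0 complex"
  proof (cases "full_norm f = 0")
    case False
    then have "full_norm f > 0" using full_norm_nonneg[of f] by simp
    moreover have "full_norm f * full_norm f \<le> full_norm (galg_star f) * full_norm f"
      using full_norm_star_mult_ge[of f] full_norm_mult[of "galg_star f" f]
      by (simp add: power2_eq_square)
    ultimately show ?thesis by simp
  qed (simp add: full_norm_nonneg)
  show ?thesis using *[of f] *[of "galg_star f"] by simp
qed

lemma full_norm_cstar: "full_norm (galg_star f * f) = (full_norm f)\<^sup>2"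
  using full_norm_star_mult_ge[of f] full_norm_mult[of "galg_star f" f]
  by (simp add: full_norm_star power2_eq_square)


text \<open>
  The full group C*-algebra is the completion of the group algebra in the maximal norm: Cauchy
  sequences modulo null sequences. (No separate quotient by elements of norm \<open>0\<close> is needed.)
\<close>

definition full_cauchy :: "(nat \<Rightarrow> ('g::group_add \<Rightarrow>\<^sub>0 complex)) \<Rightarrow> bool" where
  "full_cauchy X \<longleftrightarrow> (\<forall>e>0. \<exists>M. \<forall>m\<ge>M. \<forall>n\<ge>M. full_norm (X m - X n) < e)"

definition full_cauchy_rel ::
    "(nat \<Rightarrow> ('g::group_add \<Rightarrow>\<^sub>0 complex)) \<Rightarrow> (nat \<Rightarrow> ('g \<Rightarrow>\<^sub>0 complex)) \<Rightarrow> bool" where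
  "full_cauchy_rel X Y \<longleftrightarrow>
    full_cauchy X \<and> full_cauchy Y \<and> (\<lambda>n. full_norm (X n - Y n)) \<longlonglongrightarrow> 0"

lemma full_null_le:
  assumes "Y \<longlonglongrightarrow> 0" "\<And>n. full_norm (X n) \<le> Y n"
  shows "(\<lambda>n. full_norm (X n)) \<longlonglongrightarrow> 0"
  by (rule tendsto_sandwich[OF _ _ tendsto_const assms(1)])
     (auto simp: full_norm_nonneg assms(2))

lemma part_equivp_full_cauchy_rel: "part_equivp (full_cauchy_rel :: (nat \<Rightarrow> ('g::group_add \<Rightarrow>\<^sub>0 complex)) \<Rightarrow> _)"
proof (rule part_equivpI)
  have "full_cauchy_rel (\<lambda>_. 0 :: 'g \<Rightarrow>\<^sub>0 complex) (\<lambda>_. 0)"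
    by (simp add: full_cauchy_rel_def full_cauchy_def)
  then show "\<exists>X :: nat \<Rightarrow> ('g \<Rightarrow>\<^sub>0 complex). full_cauchy_rel X X" by blast
  show "symp (full_cauchy_rel :: (nat \<Rightarrow> ('g \<Rightarrow>\<^sub>0 complex)) \<Rightarrow> _)"
    by (rule sympI) (simp add: full_cauchy_rel_def full_norm_minus_commute)
  show "transp (full_cauchy_rel :: (nat \<Rightarrow> ('g \<Rightarrow>\<^sub>0 complex)) \<Rightarrow> _)"
  proof (rule transpI)
    fix X Y Z :: "nat \<Rightarrow> ('g \<Rightarrow>\<^sub>0 complex)"
    assume XY: "full_cauchy_rel X Y" and YZ: "full_cauchy_rel Y Z"
    then have "(\<lambda>n. full_norm (X n - Y n) + full_norm (Y n - Z n)) \<longlonglongrightarrow> 0"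
      by (auto simp: full_cauchy_rel_def intro: tendsto_add_zero)
    then have "(\<lambda>n. full_norm (X n - Z n)) \<longlonglongrightarrow> 0"
      by (rule full_null_le) (rule full_norm_triangle_diff)
    then show "full_cauchy_rel X Z" using XY YZ by (simp add: full_cauchy_rel_def)
  qed
qed

quotient_type (overloaded) 'g full_cstar = "nat \<Rightarrow> ('g::group_add \<Rightarrow>\<^sub>0 complex)" / partial: full_cauchy_rel
  by (rule part_equivp_full_cauchy_rel)

lemma full_cauchy_rel_refl: "full_cauchy X \<Longrightarrow> full_cauchy_rel X X"
  by (simp add: full_cauchy_rel_def)

lemma full_cauchy_relD:
  "full_cauchy_rel X Y \<Longrightarrow> full_cauchy X" "full_cauchy_rel X Y \<Longrightarrow> full_cauchy Y"
  "full_cauchy_rel X Y \<Longrightarrow> (\<lambda>n. full_norm (X n - Y n)) \<longlonglongrightarrow> 0"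
  by (simp_all add: full_cauchy_rel_def)

lemma full_cauchy_const: "full_cauchy (\<lambda>_. f)"
  by (simp add: full_cauchy_def)

lemma full_cauchy_norm_convergent:
  assumes "full_cauchy X"
  shows "(\<lambda>n. full_norm (X n)) \<longlonglongrightarrow> lim (\<lambda>n. full_norm (X n))"
proof -
  have "Cauchy (\<lambda>n. full_norm (X n))"
    unfolding Cauchy_def dist_real_def
  proof (intro allI impI)
    fix e :: real assume "e > 0"
    then obtain M where "\<forall>m\<ge>M. \<forall>n\<ge>M. full_norm (X m - X n) < e"
      using assms by (auto simp: full_cauchy_def)
    then show "\<exists>M. \<forall>m\<ge>M. \<forall>n\<ge>M. \<bar>full_norm (X m) - full_norm (X n)\<bar> < e"
      using full_norm_diff_le order_le_less_trans by blast
  qed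
  then show ?thesis by (simp add: Cauchy_convergent_iff convergent_LIMSEQ_iff)
qed

lemma full_cauchy_bounded:
  assumes "full_cauchy X"
  obtains K where "K > 0" "\<And>n. full_norm (X n) \<le> K"
proof -
  have "Bseq (\<lambda>n. full_norm (X n))"
    using full_cauchy_norm_convergent[OF assms] by (intro convergent_imp_Bseq) (rule convergentI)
  then obtain K where "K > 0" "\<And>n. norm (full_norm (X n)) \<le> K" by (auto elim: BseqE)
  then show ?thesis by (intro that[of K]) (auto intro: order_trans[OF abs_ge_self])
qed

lemma full_cauchyI_bound:
  assumes "full_cauchy X" "full_cauchy Y" "a \<ge> 0" "b \<ge> 0"
    and "\<And>m n. full_norm (Z m - Z n) \<le> a * full_norm (X m - X n) + b * full_norm (Y m - Y n)"
  shows "full_cauchy Z"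
  unfolding full_cauchy_def
proof (intro allI impI)
  fix e :: real assume e: "e > 0"
  define d where "d = e / (a + b + 1)"
  have d: "d > 0" using e assms by (simp add: d_def)
  obtain M where M: "\<And>m n. m \<ge> M \<Longrightarrow> n \<ge> M \<Longrightarrow> full_norm (X m - X n) < d"
    using assms(1) d unfolding full_cauchy_def by meson
  obtain N where N: "\<And>m n. m \<ge> N \<Longrightarrow> n \<ge> N \<Longrightarrow> full_norm (Y m - Y n) < d"
    using assms(2) d unfolding full_cauchy_def by meson
  have "full_norm (Z m - Z n) < e" if "m \<ge> max M N" "n \<ge> max M N" for m n
  proof -
    have "full_norm (Z m - Z n) \<le> a * full_norm (X m - X n) + b * full_norm (Y m - Y n)"
      by (rule assms)
    also have "\<dots> \<le> a * d + b * d"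
      using that M[of m n] N[of m n] assms(3,4) by (intro add_mono mult_left_mono) auto
    also have "\<dots> < (a + b + 1) * d" using d by (simp add: algebra_simps)
    also have "\<dots> = e" using assms(3,4) by (simp add: d_def)
    finally show ?thesis .
  qed
  then show "\<exists>M. \<forall>m\<ge>M. \<forall>n\<ge>M. full_norm (Z m - Z n) < e" by blast
qed

lemma full_cauchy_add:
  assumes "full_cauchy X" "full_cauchy Y" shows "full_cauchy (\<lambda>n. X n + Y n)"
proof (rule full_cauchyI_bound[OF assms, of 1 1])
  fix m n
  show "full_norm (X m + Y m - (X n + Y n)) \<le> 1 * full_norm (X m - X n) + 1 * full_norm (Y m - Y n)"
    using full_norm_triangle[of "X m - X n" "Y m - Y n"] by (simp add: algebra_simps)
qed auto

lemma full_cauchy_scale: "full_cauchy X \<Longrightarrow> full_cauchy (\<lambda>n. galg_scale c (X n))"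
  by (rule full_cauchyI_bound[of X X "cmod c" 0])
     (simp_all flip: galg_scale_diff add: full_norm_scale)

lemma full_cauchy_star: "full_cauchy X \<Longrightarrow> full_cauchy (\<lambda>n. galg_star (X n))"
  by (rule full_cauchyI_bound[of X X 1 0])
     (simp_all flip: galg_star_diff add: full_norm_star)

lemma full_norm_mult_diff:
  "full_norm (f * h - f' * h') \<le> full_norm f * full_norm (h - h') + full_norm (f - f') * full_norm h'"
proof -
  have "f * h - f' * h' = f * (h - h') + (f - f') * h'" by (simp add: algebra_simps)
  then show ?thesis
    using full_norm_triangle[of "f * (h - h')" "(f - f') * h'"]
      full_norm_mult[of f "h - h'"] full_norm_mult[of "f - f'" h'] by simp
qed

lemma full_cauchy_mult:
  assumes "full_cauchy X" "full_cauchy Y" shows "full_cauchy (\<lambda>n. X n * Y n)"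
proof -
  obtain K where K: "K > 0" "\<And>n. full_norm (X n) \<le> K" using full_cauchy_bounded[OF assms(1)] by blast
  obtain L where L: "L > 0" "\<And>n. full_norm (Y n) \<le> L" using full_cauchy_bounded[OF assms(2)] by blast
  show ?thesis
  proof (rule full_cauchyI_bound[OF assms(2,1), of K L])
    fix m n
    have "full_norm (X m * Y m - X n * Y n)
        \<le> full_norm (X m) * full_norm (Y m - Y n) + full_norm (X m - X n) * full_norm (Y n)"
      by (rule full_norm_mult_diff)
    also have "\<dots> \<le> K * full_norm (Y m - Y n) + full_norm (X m - X n) * L"
      by (intro add_mono mult_mono K L full_norm_nonneg order_refl) (use K in auto)
    finally show "full_norm (X m * Y m - X n * Y n)
        \<le> K * full_norm (Y m - Y n) + L * full_norm (X m - X n)"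
      by (simp add: mult.commute)
  qed (use K L in auto)
qed

lemma full_cauchy_rel_add:
  assumes "full_cauchy_rel X X'" "full_cauchy_rel Y Y'"
  shows "full_cauchy_rel (\<lambda>n. X n + Y n) (\<lambda>n. X' n + Y' n)"
proof -
  have "(\<lambda>n. full_norm (X n + Y n - (X' n + Y' n))) \<longlonglongrightarrow> 0"
  proof (rule full_null_le)
    show "(\<lambda>n. full_norm (X n - X' n) + full_norm (Y n - Y' n)) \<longlonglongrightarrow> 0"
      using assms by (intro tendsto_add_zero full_cauchy_relD)
    show "full_norm (X n + Y n - (X' n + Y' n)) \<le> full_norm (X n - X' n) + full_norm (Y n - Y' n)" for n
      using full_norm_triangle[of "X n - X' n" "Y n - Y' n"] by (simp add: algebra_simps)
  qed
  then show ?thesis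
    using assms by (simp add: full_cauchy_rel_def full_cauchy_add)
qed

lemma full_cauchy_rel_scale:
  assumes "full_cauchy_rel X X'"
  shows "full_cauchy_rel (\<lambda>n. galg_scale c (X n)) (\<lambda>n. galg_scale c (X' n))"
  using assms tendsto_mult_right_zero[OF full_cauchy_relD(3)[OF assms], of "cmod c"]
  by (simp add: full_cauchy_rel_def full_cauchy_scale full_norm_scale flip: galg_scale_diff)

lemma full_cauchy_rel_star:
  assumes "full_cauchy_rel X X'"
  shows "full_cauchy_rel (\<lambda>n. galg_star (X n)) (\<lambda>n. galg_star (X' n))"
  using assms by (simp add: full_cauchy_rel_def full_cauchy_star full_norm_star flip: galg_star_diff)

lemma full_cauchy_rel_diff:
  assumes "full_cauchy_rel X X'" "full_cauchy_rel Y Y'"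
  shows "full_cauchy_rel (\<lambda>n. X n - Y n) (\<lambda>n. X' n - Y' n)"
  using full_cauchy_rel_add[OF assms(1) full_cauchy_rel_scale[OF assms(2), of "- 1"]]
  by (simp add: galg_scale_minus_one)

lemma full_cauchy_rel_mult:
  assumes "full_cauchy_rel X X'" "full_cauchy_rel Y Y'"
  shows "full_cauchy_rel (\<lambda>n. X n * Y n) (\<lambda>n. X' n * Y' n)"
proof -
  obtain K where K: "K > 0" "\<And>n. full_norm (X n) \<le> K"
    using full_cauchy_bounded[OF full_cauchy_relD(1)[OF assms(1)]] by blast
  obtain L where L: "L > 0" "\<And>n. full_norm (Y' n) \<le> L"
    using full_cauchy_bounded[OF full_cauchy_relD(2)[OF assms(2)]] by blast
  have "(\<lambda>n. full_norm (X n * Y n - X' n * Y' n)) \<longlonglongrightarrow> 0"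
  proof (rule full_null_le)
    show "(\<lambda>n. K * full_norm (Y n - Y' n) + full_norm (X n - X' n) * L) \<longlonglongrightarrow> 0"
      using assms
      by (intro tendsto_add_zero tendsto_mult_right_zero tendsto_mult_left_zero full_cauchy_relD)
    fix n
    have "full_norm (X n * Y n - X' n * Y' n)
        \<le> full_norm (X n) * full_norm (Y n - Y' n) + full_norm (X n - X' n) * full_norm (Y' n)"
      by (rule full_norm_mult_diff)
    also have "\<dots> \<le> K * full_norm (Y n - Y' n) + full_norm (X n - X' n) * L"
      by (intro add_mono mult_mono K L full_norm_nonneg order_refl) (use K in auto)
    finally show "full_norm (X n * Y n - X' n * Y' n)
        \<le> K * full_norm (Y n - Y' n) + full_norm (X n - X' n) * L" .
  qed
  then show ?thesis
    using assms by (simp add: full_cauchy_rel_def full_cauchy_mult)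
qed

lemma full_cauchy_rel_norm:
  assumes "full_cauchy_rel X Y"
  shows "lim (\<lambda>n. full_norm (X n)) = lim (\<lambda>n. full_norm (Y n))"
proof -
  have "(\<lambda>n. full_norm (X n) - full_norm (Y n)) \<longlonglongrightarrow> 0"
    using full_cauchy_relD(3)[OF assms]
    by (rule Lim_null_comparison[rotated]) (simp add: full_norm_diff_le)
  moreover have "(\<lambda>n. full_norm (X n) - full_norm (Y n))
      \<longlonglongrightarrow> lim (\<lambda>n. full_norm (X n)) - lim (\<lambda>n. full_norm (Y n))"
    using assms by (intro tendsto_diff full_cauchy_norm_convergent full_cauchy_relD)
  ultimately show ?thesis using LIMSEQ_unique by fastforce
qed

instantiation full_cstar :: (group_add) "{complex_vector, ring_1}"
begin

lift_definition zero_full_cstar :: "'a full_cstar" is "\<lambda>_. 0"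
  by (rule full_cauchy_rel_refl[OF full_cauchy_const])
lift_definition one_full_cstar :: "'a full_cstar" is "\<lambda>_. 1"
  by (rule full_cauchy_rel_refl[OF full_cauchy_const])
lift_definition plus_full_cstar :: "'a full_cstar \<Rightarrow> 'a full_cstar \<Rightarrow> 'a full_cstar"
  is "\<lambda>X Y n. X n + Y n" by (rule full_cauchy_rel_add)
lift_definition times_full_cstar :: "'a full_cstar \<Rightarrow> 'a full_cstar \<Rightarrow> 'a full_cstar"
  is "\<lambda>X Y n. X n * Y n" by (rule full_cauchy_rel_mult)
lift_definition scaleC_full_cstar :: "complex \<Rightarrow> 'a full_cstar \<Rightarrow> 'a full_cstar"
  is "\<lambda>c X n. galg_scale c (X n)" by (rule full_cauchy_rel_scale)
definition scaleR_full_cstar :: "real \<Rightarrow> 'a full_cstar \<Rightarrow> 'a full_cstar" where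
  "scaleR_full_cstar r x = complex_of_real r *\<^sub>C x"
definition uminus_full_cstar :: "'a full_cstar \<Rightarrow> 'a full_cstar" where
  "uminus_full_cstar x = (- 1) *\<^sub>C x"
lift_definition minus_full_cstar :: "'a full_cstar \<Rightarrow> 'a full_cstar \<Rightarrow> 'a full_cstar"
  is "\<lambda>X Y n. X n - Y n" by (rule full_cauchy_rel_diff)

instance
proof
  fix x y z :: "'a full_cstar" and a b :: complex and r s :: real
  have add_right: "a *\<^sub>C (x + y) = a *\<^sub>C x + a *\<^sub>C y" for a and x y :: "'a full_cstar"
    by transfer (simp add: galg_scale_add full_cauchy_rel_add full_cauchy_rel_scale)
  have add_left: "(a + b) *\<^sub>C x = a *\<^sub>C x + b *\<^sub>C x" for a b and x :: "'a full_cstar"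
    by transfer (simp add: galg_scale_add_left full_cauchy_rel_add full_cauchy_rel_scale)
  have scale: "a *\<^sub>C b *\<^sub>C x = (a * b) *\<^sub>C x" for a b and x :: "'a full_cstar"
    by transfer (simp add: galg_scale_scale full_cauchy_rel_scale)
  have one: "1 *\<^sub>C x = x" for x :: "'a full_cstar"
    by transfer simp
  show "a *\<^sub>C (x + y) = a *\<^sub>C x + a *\<^sub>C y" by (rule add_right)
  show "(a + b) *\<^sub>C x = a *\<^sub>C x + b *\<^sub>C x" by (rule add_left)
  show "a *\<^sub>C b *\<^sub>C x = (a * b) *\<^sub>C x" by (rule scale)
  show "r *\<^sub>R x = complex_of_real r *\<^sub>C x" by (simp add: scaleR_full_cstar_def)
  show "r *\<^sub>R (x + y) = r *\<^sub>R x + r *\<^sub>R y" by (simp add: scaleR_full_cstar_def add_right)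
  show "(r + s) *\<^sub>R x = r *\<^sub>R x + s *\<^sub>R x" by (simp add: scaleR_full_cstar_def add_left)
  show "r *\<^sub>R s *\<^sub>R x = (r * s) *\<^sub>R x" by (simp add: scaleR_full_cstar_def scale)
  show "1 *\<^sub>R x = x" by (simp add: scaleR_full_cstar_def one)
  show "x + y + z = x + (y + z)"
    by transfer (simp add: add.assoc full_cauchy_rel_add)
  show "x + y = y + x"
    by transfer (simp add: add.commute full_cauchy_rel_add)
  show "0 + x = x" by transfer simp
  show "- x + x = 0"
    unfolding uminus_full_cstar_def
    by transfer (simp add: galg_scale_minus_one full_cauchy_rel_refl full_cauchy_const)
  show "x - y = x + - y" unfolding uminus_full_cstar_def
    by transfer (simp add: galg_scale_minus_one full_cauchy_rel_diff)
  show "x * y * z = x * (y * z)"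
    by transfer (simp add: mult.assoc full_cauchy_rel_mult)
  show "(x + y) * z = x * z + y * z"
    by transfer (simp add: distrib_right full_cauchy_rel_mult full_cauchy_rel_add)
  show "x * (y + z) = x * y + x * z"
    by transfer (simp add: distrib_left full_cauchy_rel_mult full_cauchy_rel_add)
  show "1 * x = x" by transfer simp
  show "x * 1 = x" by transfer simp
  show "(0 :: 'a full_cstar) \<noteq> 1"
    by transfer (simp add: full_cauchy_rel_def full_norm_uminus LIMSEQ_const_iff)
qed

end

instantiation full_cstar :: (group_add) real_normed_algebra_1
begin

lift_definition norm_full_cstar :: "'a full_cstar \<Rightarrow> real" is "\<lambda>X. lim (\<lambda>n. full_norm (X n))"
  by (rule full_cauchy_rel_norm)
definition dist_full_cstar :: "'a full_cstar \<Rightarrow> 'a full_cstar \<Rightarrow> real" where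
  "dist_full_cstar x y = norm (x - y)"
definition sgn_full_cstar :: "'a full_cstar \<Rightarrow> 'a full_cstar" where
  "sgn_full_cstar x = x /\<^sub>R norm x"
definition uniformity_full_cstar :: "('a full_cstar \<times> 'a full_cstar) filter" where
  "uniformity_full_cstar = (INF e\<in>{0 <..}. principal {(x, y). dist x y < e})"
definition open_full_cstar :: "'a full_cstar set \<Rightarrow> bool" where
  "open_full_cstar U \<longleftrightarrow> (\<forall>x\<in>U. eventually (\<lambda>(x', y). x' = x \<longrightarrow> y \<in> U) uniformity)"

instance
proof
  fix x y :: "'a full_cstar" and r :: real and U :: "'a full_cstar set"
  show "dist x y = norm (x - y)" by (rule dist_full_cstar_def)
  show "sgn x = x /\<^sub>R norm x" by (rule sgn_full_cstar_def)
  show "(uniformity :: ('a full_cstar \<times> 'a full_cstar) filter) =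
      (INF e\<in>{0 <..}. principal {(x, y). dist x y < e})" by (rule uniformity_full_cstar_def)
  show "open U \<longleftrightarrow> (\<forall>x\<in>U. eventually (\<lambda>(x', y). x' = x \<longrightarrow> y \<in> U) uniformity)"
    by (rule open_full_cstar_def)
  show "norm x = 0 \<longleftrightarrow> x = 0"
  proof transfer
    fix X :: "nat \<Rightarrow> ('a \<Rightarrow>\<^sub>0 complex)"
    assume "full_cauchy_rel X X"
    then have "(\<lambda>n. full_norm (X n)) \<longlonglongrightarrow> lim (\<lambda>n. full_norm (X n))" and "full_cauchy X"
      by (auto intro: full_cauchy_norm_convergent full_cauchy_relD)
    then show "lim (\<lambda>n. full_norm (X n)) = 0 \<longleftrightarrow> full_cauchy_rel X (\<lambda>_. 0)"
      by (auto simp: full_cauchy_rel_def full_cauchy_const intro: LIMSEQ_unique)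
  qed
  show "norm (x + y) \<le> norm x + norm y"
  proof transfer
    fix X Y :: "nat \<Rightarrow> ('a \<Rightarrow>\<^sub>0 complex)"
    assume XY: "full_cauchy_rel X X" "full_cauchy_rel Y Y"
    show "lim (\<lambda>n. full_norm (X n + Y n)) \<le> lim (\<lambda>n. full_norm (X n)) + lim (\<lambda>n. full_norm (Y n))"
      by (rule LIMSEQ_le[OF full_cauchy_norm_convergent
            tendsto_add[OF full_cauchy_norm_convergent full_cauchy_norm_convergent]])
         (use XY in \<open>auto intro!: full_cauchy_add full_norm_triangle dest: full_cauchy_relD\<close>)
  qed
  show "norm (x * y) \<le> norm x * norm y"
  proof transfer
    fix X Y :: "nat \<Rightarrow> ('a \<Rightarrow>\<^sub>0 complex)"
    assume XY: "full_cauchy_rel X X" "full_cauchy_rel Y Y"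
    show "lim (\<lambda>n. full_norm (X n * Y n)) \<le> lim (\<lambda>n. full_norm (X n)) * lim (\<lambda>n. full_norm (Y n))"
      by (rule LIMSEQ_le[OF full_cauchy_norm_convergent
            tendsto_mult[OF full_cauchy_norm_convergent full_cauchy_norm_convergent]])
         (use XY in \<open>auto intro!: full_cauchy_mult full_norm_mult dest: full_cauchy_relD\<close>)
  qed
  show "norm (r *\<^sub>R x) = \<bar>r\<bar> * norm x"
    unfolding scaleR_full_cstar_def
  proof transfer
    fix r :: real and X :: "nat \<Rightarrow> ('a \<Rightarrow>\<^sub>0 complex)"
    assume X: "full_cauchy_rel X X"
    show "lim (\<lambda>n. full_norm (galg_scale (complex_of_real r) (X n))) = \<bar>r\<bar> * lim (\<lambda>n. full_norm (X n))"
      unfolding full_norm_scale norm_of_real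
      by (intro limI tendsto_mult_left full_cauchy_norm_convergent full_cauchy_relD[OF X])
  qed
  show "norm (1 :: 'a full_cstar) = 1" by transfer simp
  show "r *\<^sub>R x * y = r *\<^sub>R (x * y)"
    unfolding scaleR_full_cstar_def
    by transfer (simp add: galg_scale_mult_left full_cauchy_rel_mult full_cauchy_rel_scale)
  show "x * r *\<^sub>R y = r *\<^sub>R (x * y)"
    unfolding scaleR_full_cstar_def
    by transfer (simp add: galg_scale_mult_right full_cauchy_rel_mult full_cauchy_rel_scale)
qed

end

definition of_galg :: "('g::group_add \<Rightarrow>\<^sub>0 complex) \<Rightarrow> 'g full_cstar" where
  "of_galg f = abs_full_cstar (\<lambda>_. f)"

lemma norm_of_galg: "norm (of_galg f) = full_norm f"
  unfolding of_galg_def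
  by (subst norm_full_cstar.abs_eq) (simp_all add: full_cauchy_rel_refl full_cauchy_const)

lemma of_galg_diff: "of_galg (f - h) = of_galg f - of_galg h"
  unfolding of_galg_def
  by (subst minus_full_cstar.abs_eq) (simp_all add: full_cauchy_rel_refl full_cauchy_const)

lemma of_galg_tendsto:
  assumes "full_cauchy X"
  shows "(\<lambda>n. of_galg (X n)) \<longlonglongrightarrow> abs_full_cstar X"
proof (rule LIMSEQ_I)
  fix e :: real assume "e > 0"
  then have "e / 2 > 0" by simp
  then obtain M where M: "\<And>m n. m \<ge> M \<Longrightarrow> n \<ge> M \<Longrightarrow> full_norm (X m - X n) < e / 2"
    using assms unfolding full_cauchy_def by meson
  have "norm (of_galg (X m) - abs_full_cstar X) < e" if "m \<ge> M" for m
  proof -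
    have rel: "full_cauchy_rel X X" "full_cauchy_rel (\<lambda>_. X m) (\<lambda>_. X m)"
      using assms by (simp_all add: full_cauchy_rel_refl full_cauchy_const)
    have diff: "full_cauchy_rel (\<lambda>n. X m - X n) (\<lambda>n. X m - X n)"
      by (rule full_cauchy_rel_diff[OF rel(2,1)])
    have "norm (of_galg (X m) - abs_full_cstar X) = lim (\<lambda>n. full_norm (X m - X n))"
      unfolding of_galg_def minus_full_cstar.abs_eq[OF rel(2,1)] norm_full_cstar.abs_eq[OF diff] ..
    also have "\<dots> \<le> e / 2"
      using M[OF that] full_cauchy_norm_convergent[OF full_cauchy_relD(1)[OF diff]]
      by (intro LIMSEQ_le_const2) (auto intro: less_imp_le)
    finally have "norm (of_galg (X m) - abs_full_cstar X) \<le> e / 2" .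
    then show ?thesis using \<open>e > 0\<close> by simp
  qed
  then show "\<exists>M. \<forall>m\<ge>M. norm (of_galg (X m) - abs_full_cstar X) < e" by blast
qed

lemma of_galg_dense:
  assumes "e > 0"
  obtains f where "norm (x - of_galg f) < e"
proof -
  have "\<exists>X. full_cauchy X \<and> x = abs_full_cstar X"
    by (rule full_cstar.abs_induct[of _ x]) (use full_cauchy_relD(1) in blast)
  then obtain X where X: "full_cauchy X" "x = abs_full_cstar X" by blast
  have "\<forall>\<^sub>F n in sequentially. dist (of_galg (X n)) x < e"
    unfolding X(2) by (rule tendstoD[OF of_galg_tendsto[OF X(1)] assms])
  then obtain n where "dist (of_galg (X n)) x < e"
    using eventually_happens'[OF sequentially_bot] by blast
  then show ?thesis
    unfolding dist_norm by (intro that[of "X n"]) (subst norm_minus_commute)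
qed

instantiation full_cstar :: (group_add) cstar_algebra
begin

lift_definition star_full_cstar :: "'a full_cstar \<Rightarrow> 'a full_cstar" is "\<lambda>X n. galg_star (X n)"
  by (rule full_cauchy_rel_star)

instance
proof
  fix x y :: "'a full_cstar" and a :: complex
  show "a *\<^sub>C x * y = a *\<^sub>C (x * y)"
    by transfer (simp add: galg_scale_mult_left full_cauchy_rel_mult full_cauchy_rel_scale)
  show "x * a *\<^sub>C y = a *\<^sub>C (x * y)"
    by transfer (simp add: galg_scale_mult_right full_cauchy_rel_mult full_cauchy_rel_scale)
  show "norm (a *\<^sub>C x) = cmod a * norm x"
  proof transfer
    fix a and X :: "nat \<Rightarrow> ('a \<Rightarrow>\<^sub>0 complex)"
    assume X: "full_cauchy_rel X X"
    show "lim (\<lambda>n. full_norm (galg_scale a (X n))) = cmod a * lim (\<lambda>n. full_norm (X n))"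
      unfolding full_norm_scale
      by (intro limI tendsto_mult_left full_cauchy_norm_convergent full_cauchy_relD[OF X])
  qed
  show "star (star x) = x" by transfer simp
  show "star (x + y) = star x + star y"
    by transfer (simp add: galg_star_add full_cauchy_rel_add full_cauchy_rel_star)
  show "star (a *\<^sub>C x) = cnj a *\<^sub>C star x"
    by transfer (simp add: galg_star_scale full_cauchy_rel_scale full_cauchy_rel_star)
  show "star (x * y) = star y * star x"
    by transfer (simp add: galg_star_mult full_cauchy_rel_mult full_cauchy_rel_star)
  show "norm (star x * x) = (norm x)\<^sup>2"
  proof transfer
    fix X :: "nat \<Rightarrow> ('a \<Rightarrow>\<^sub>0 complex)"
    assume X: "full_cauchy_rel X X"
    show "lim (\<lambda>n. full_norm (galg_star (X n) * X n)) = (lim (\<lambda>n. full_norm (X n)))\<^sup>2"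
      unfolding full_norm_cstar
      by (intro limI tendsto_power full_cauchy_norm_convergent full_cauchy_relD[OF X])
  qed
next
  fix S :: "nat \<Rightarrow> 'a full_cstar"
  assume S: "Cauchy S"
  have "\<exists>f. norm (S n - of_galg f) < inverse (Suc n)" for n
    using of_galg_dense[of "inverse (Suc n)" "S n"] by auto
  then obtain X where X: "\<And>n. norm (S n - of_galg (X n)) < inverse (Suc n)"
    by metis
  have null: "(\<lambda>n. S n - of_galg (X n)) \<longlonglongrightarrow> 0"
    by (rule Lim_null_comparison[OF _ LIMSEQ_inverse_real_of_nat])
       (use X in \<open>auto intro: always_eventually less_imp_le\<close>)
  have "full_cauchy X"
    unfolding full_cauchy_def
  proof (intro allI impI)
    fix e :: real assume "e > 0"
    then have e3: "e / 3 > 0" by simp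
    obtain M where M: "\<And>m n. m \<ge> M \<Longrightarrow> n \<ge> M \<Longrightarrow> norm (S m - S n) < e / 3"
      using S e3 unfolding Cauchy_def dist_norm by meson
    obtain N where N: "\<And>n. n \<ge> N \<Longrightarrow> norm (S n - of_galg (X n)) < e / 3"
      using LIMSEQ_D[OF null e3] by auto
    have "full_norm (X m - X n) < e" if "m \<ge> max M N" "n \<ge> max M N" for m n
    proof -
      have "of_galg (X m - X n)
          = (S m - S n) - (S m - of_galg (X m)) + (S n - of_galg (X n))"
        by (simp add: of_galg_diff)
      then have "full_norm (X m - X n)
          \<le> norm (S m - S n) + norm (S m - of_galg (X m)) + norm (S n - of_galg (X n))"
        by (metis norm_of_galg norm_triangle_le add_right_mono norm_triangle_ineq4)
      then show ?thesis using M[of m n] N[of m] N[of n] that by simp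
    qed
    then show "\<exists>M. \<forall>m\<ge>M. \<forall>n\<ge>M. full_norm (X m - X n) < e" by blast
  qed
  from tendsto_add[OF null of_galg_tendsto[OF this]]
  show "convergent S" by (auto intro: convergentI)
qed

end

end

theory Submission
  imports Defs
begin

text \<open>
  The real parts \<open>x\<^sub>i\<close> of the generators have no perturbation by less than \<open>1\<close> with an invertible
  finite sum of squares. Every point of the infinite torus gives a character of the algebra; on the
  half circles parametrised by \<open>t\<^sub>i \<in> [0, 1]\<close> it sends \<open>x\<^sub>i\<close> to \<open>cos (\<pi> t\<^sub>i)\<close>. If \<open>y\<^sub>i\<close> is
  self-adjoint and close to \<open>x\<^sub>i\<close>, its character value is real, positive on the face \<open>t\<^sub>i = 0\<close> and
  negative on the face \<open>t\<^sub>i = 1\<close> of the cube, so by the Poincare--Miranda theorem some character makes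
  any finite number of the \<open>y\<^sub>i\<close> arbitrarily small, whereas a left inverse of the sum of their
  squares bounds that sum away from \<open>0\<close> at every character. It suffices to have characters on the
  group algebra: there they are Lipschitz in \<open>t\<close>, and by density \<open>y\<^sub>i\<close> and the inverse can be
  approximated from it.
\<close>

section \<open>An approximate Poincare--Miranda theorem\<close>

text \<open>Label the vertices of a fine grid by the signs of the \<open>\<phi> i\<close>. The face
  conditions are those of Kuhn's lemma, which yields a cell on which every label takes both values;
  the Lipschitz bound then makes every \<open>\<phi> i\<close> small at the corner \<open>q\<close>
  of that cell.\<close>

lemma approximate_Poincare_Miranda:
  fixes \<phi> :: "nat \<Rightarrow> (nat \<Rightarrow> real) \<Rightarrow> real"
  assumes pos: "\<And>i t. i < n \<Longrightarrow> \<forall>j. t j \<in> {0..1} \<Longrightarrow> t i = 0 \<Longrightarrow> 0 < \<phi> i t"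
    and neg: "\<And>i t. i < n \<Longrightarrow> \<forall>j. t j \<in> {0..1} \<Longrightarrow> t i = 1 \<Longrightarrow> \<phi> i t < 0"
    and lipschitz: "\<And>i t t' d. i < n \<Longrightarrow> \<forall>j. \<bar>t j - t' j\<bar> \<le> d \<Longrightarrow> \<bar>\<phi> i t - \<phi> i t'\<bar> \<le> L * d"
    and "0 < \<delta>"
  obtains t where "\<forall>j. t j \<in> {0..1}" "\<forall>i<n. \<bar>\<phi> i t\<bar> \<le> \<delta>"
proof -
  \<comment> \<open>A grid of mesh \<open>1 / p\<close> on which each \<open>\<phi> i\<close> varies
    by at most \<open>\<delta>\<close> between \<open>q\<close> and any vertex of its cell.\<close>
  obtain p :: nat where "real p > max 0 (L / \<delta>)"
    using reals_Archimedean2 by blast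
  then have p: "0 < p" "L / real p \<le> \<delta>"
    using \<open>0 < \<delta>\<close> by (auto simp: field_simps)
  \<comment> \<open>Coordinates from \<open>n\<close> on are frozen at 0, which embeds the
    \<open>n\<close>-dimensional grid in the infinite cube.\<close>
  define t where "t x j = (if j < n then real (x j) / real p else 0)" for x :: "nat \<Rightarrow> nat" and j
  define label where "label x i = (if 0 < \<phi> i (t x) then 0 else 1 :: nat)" for x i
  have t01: "\<forall>j. t x j \<in> {0..1}" if "\<forall>j<n. x j \<le> p" for x
    using that p by (auto simp: t_def)
  obtain q where q: "\<forall>j<n. q j < p" and close: "\<forall>i<n. \<exists>r s. (\<forall>j<n. q j \<le> r j \<and> r j \<le> q j + 1) \<and>
      (\<forall>j<n. q j \<le> s j \<and> s j \<le> q j + 1) \<and> label r i \<noteq> label s i"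
  proof (rule kuhn_lemma[of p n label])
    show "\<forall>x. (\<forall>i<n. x i \<le> p) \<longrightarrow> (\<forall>i<n. x i = 0 \<longrightarrow> label x i = 0)"
    proof (intro allI impI)
      fix x i assume "\<forall>i<n. x i \<le> p" "i < n" "x i = 0"
      moreover from this have "t x i = 0" by (simp add: t_def)
      ultimately show "label x i = 0"
        using pos[OF _ t01, of i x] by (simp add: label_def)
    qed
    show "\<forall>x. (\<forall>i<n. x i \<le> p) \<longrightarrow> (\<forall>i<n. x i = p \<longrightarrow> label x i = 1)"
    proof (intro allI impI)
      fix x i assume "\<forall>i<n. x i \<le> p" "i < n" "x i = p"
      moreover from this have "t x i = 1" using p by (simp add: t_def)
      ultimately show "label x i = 1"
        using neg[OF _ t01, of i x] by (force simp: label_def)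
    qed
  qed (use p in \<open>auto simp: label_def\<close>)
  have "\<bar>\<phi> i (t q)\<bar> \<le> \<delta>" if "i < n" for i
  proof -
    obtain r s where rs: "\<forall>j<n. q j \<le> r j \<and> r j \<le> q j + 1" "\<forall>j<n. q j \<le> s j \<and> s j \<le> q j + 1"
      and ne: "label r i \<noteq> label s i"
      using close \<open>i < n\<close> by blast
    have near: "\<bar>\<phi> i (t q) - \<phi> i (t x)\<bar> \<le> \<delta>" if "\<forall>j<n. q j \<le> x j \<and> x j \<le> q j + 1" for x
    proof -
      have "\<bar>t q j - t x j\<bar> \<le> 1 / real p" for j
      proof (cases "j < n")
        case True
        then have "\<bar>real (q j) - real (x j)\<bar> \<le> 1" using that by fastforce
        then show ?thesis using True p
          by (simp add: t_def divide_right_mono flip: diff_divide_distrib)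
      qed (simp add: t_def)
      then have "\<bar>\<phi> i (t q) - \<phi> i (t x)\<bar> \<le> L * (1 / real p)"
        using lipschitz \<open>i < n\<close> by blast
      then show ?thesis using p by simp
    qed
    \<comment> \<open>Different labels mean that \<open>\<phi> i\<close> is positive at one of the
      two vertices and nonpositive at the other, and both values lie within \<open>\<delta>\<close>
      of the value at \<open>q\<close>.\<close>
    from near[OF rs(1)] near[OF rs(2)] ne show ?thesis
      by (auto simp: label_def split: if_splits)
  qed
  moreover have "\<forall>j. t q j \<in> {0..1}"
    using q by (intro t01) (auto intro: less_imp_le)
  ultimately show thesis using that by blast
qed

section \<open>Unimodular characters of the free group\<close>

text \<open>A chord of the unit circle, of length \<open>2 * \<bar>sin ((a - b) / 2)\<bar>\<close>,
  is no longer than its arc.\<close>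

lemma norm_cis_diff_le: "cmod (cis a - cis b) \<le> \<bar>a - b\<bar>"
proof -
  have "cis a - cis b = cis b * (cis (a - b) - 1)"
    by (simp add: right_diff_distrib cis_mult)
  moreover have "cmod (cis (a - b) - 1) \<le> \<bar>a - b\<bar>"
    using dist_exp_i_1[of "a - b"] abs_sin_x_le_abs_x[of "(a - b) / 2"]
    by (simp add: dist_norm cis_conv_exp)
  ultimately show ?thesis by (simp add: norm_mult)
qed

lift_definition free_generator :: "'i \<Rightarrow> 'i free_group" is "\<lambda>i. [(i, True)]"
  by (simp add: reduced_word_Cons)

text \<open>Conjugation stands in for inversion: the two agree on the unit circle, where
  \<open>u\<close> will take its values.\<close>

definition letter_value :: "('i \<Rightarrow> complex) \<Rightarrow> 'i \<times> bool \<Rightarrow> complex" where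
  "letter_value u a = (if snd a then u (fst a) else cnj (u (fst a)))"

text \<open>For unimodular \<open>u\<close> this is the homomorphism to the circle given by the
  universal property of the free group.\<close>

lift_definition free_char :: "('i \<Rightarrow> complex) \<Rightarrow> 'i free_group \<Rightarrow> complex"
  is "\<lambda>u w. prod_list (map (letter_value u) w)" .

lift_definition word_length :: "'i free_group \<Rightarrow> nat" is length .

lemma norm_letter_value: "\<forall>i. cmod (u i) = 1 \<Longrightarrow> cmod (letter_value u a) = 1"
  by (simp add: letter_value_def)

lemma letter_value_inv: "letter_value u (inv_letter a) = cnj (letter_value u a)"
  by (cases a) (simp add: letter_value_def)

text \<open>When two adjacent letters cancel, their values multiply to 1. This is what makes
  \<open>free_char\<close> multiplicative.\<close>

lemma prod_list_push_letter:
  assumes "\<forall>i. cmod (u i) = 1"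
  shows "prod_list (map (letter_value u) (push_letter a w)) =
    letter_value u a * prod_list (map (letter_value u) w)"
proof (cases w)
  case (Cons b v)
  have "letter_value u a * cnj (letter_value u a) = 1"
    using norm_letter_value[OF assms, of a] by (simp flip: complex_norm_square)
  then show ?thesis using Cons
    by (auto simp: letter_value_inv simp flip: mult.assoc)
qed simp

context
  fixes u :: "'i \<Rightarrow> complex"
  assumes unimodular: "\<forall>i. cmod (u i) = 1"
begin

lemma free_char_add: "free_char u (g + h) = free_char u g * free_char u h"
proof (transfer fixing: u)
  fix v w :: "('i \<times> bool) list"
  show "prod_list (map (letter_value u) (foldr push_letter v w)) =
      prod_list (map (letter_value u) v) * prod_list (map (letter_value u) w)"
    by (induction v) (simp_all add: prod_list_push_letter unimodular mult.assoc)
qed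

lemma free_char_zero: "free_char u 0 = 1"
  by transfer simp

lemma norm_free_char: "cmod (free_char u g) = 1"
proof (transfer fixing: u)
  fix w :: "('i \<times> bool) list"
  show "cmod (prod_list (map (letter_value u) w)) = 1"
    by (induction w) (simp_all add: norm_mult norm_letter_value unimodular)
qed

end

lemma free_char_generator: "free_char u (free_generator i) = u i"
  by transfer (simp add: letter_value_def)

text \<open>Changing the letters one at a time costs at most \<open>d\<close> each, because all
  other factors have modulus 1.\<close>

lemma free_char_lipschitz:
  assumes "\<forall>i. cmod (u i) = 1" "\<forall>i. cmod (v i) = 1" and d: "\<forall>i. cmod (u i - v i) \<le> d"
  shows "cmod (free_char u g - free_char v g) \<le> real (word_length g) * d"
proof (transfer fixing: u v d)
  fix g :: "('a \<times> bool) list"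
  show "cmod (prod_list (map (letter_value u) g) - prod_list (map (letter_value v) g))
      \<le> real (length g) * d"
  proof (induction g)
    case (Cons a g)
    let ?P = "prod_list (map (letter_value u) g)" and ?Q = "prod_list (map (letter_value v) g)"
    have Q: "cmod ?Q = 1"
      by (induction g) (simp_all add: norm_mult norm_letter_value assms)
    have "letter_value u a - letter_value v a = u (fst a) - v (fst a) \<or>
        letter_value u a - letter_value v a = cnj (u (fst a) - v (fst a))"
      by (simp add: letter_value_def)
    then have a: "cmod (letter_value u a - letter_value v a) \<le> d"
      using d by (metis complex_mod_cnj)
    have "letter_value u a * ?P - letter_value v a * ?Q =
        letter_value u a * (?P - ?Q) + (letter_value u a - letter_value v a) * ?Q"
      by (simp add: algebra_simps)
    also have "cmod \<dots> \<le> cmod (?P - ?Q) + cmod (letter_value u a - letter_value v a)"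
      by (rule order_trans[OF norm_triangle_ineq]) (simp add: norm_mult norm_letter_value assms Q)
    finally show ?case using Cons a by (simp add: algebra_simps)
  qed simp
qed

section \<open>Extension of characters to the group algebra\<close>

definition galg_char :: "('g \<Rightarrow> complex) \<Rightarrow> ('g \<Rightarrow>\<^sub>0 complex) \<Rightarrow> complex" where
  "galg_char c f = (\<Sum>g\<in>Poly_Mapping.keys f. Poly_Mapping.lookup f g * c g)"

lemma scaleC_left_sum: "(\<Sum>i\<in>A. f i) *\<^sub>C (x :: 'a::complex_vector) = (\<Sum>i\<in>A. f i *\<^sub>C x)"
proof -
  have "0 *\<^sub>C x = 0" using scaleR_scaleC[of 0 x] by simp
  then show ?thesis
    by (induction A rule: infinite_finite_induct) (simp_all add: scaleC_add_left)
qed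

text \<open>A character acts on any \<open>ell2\<close> space by scalars. Facts about
  \<open>algebra_rep\<close> thereby become facts about \<open>galg_char\<close>, once a nonzero
  vector is cancelled.\<close>

lemma algebra_rep_char: "algebra_rep (\<lambda>g. (*\<^sub>C) (c g)) f \<xi> = galg_char c f *\<^sub>C \<xi>"
  by (simp add: algebra_rep_def galg_char_def scaleC_left_sum scaleC_scaleC)

lemma scaleC_cancel_right_ell2:
  assumes "(x :: 'x ell2) \<noteq> 0" "a *\<^sub>C x = b *\<^sub>C x" shows "a = b"
proof -
  have "(a - b) *\<^sub>C x + b *\<^sub>C x = 0 + b *\<^sub>C x"
    using assms(2) by (simp flip: scaleC_add_left)
  then have "(a - b) *\<^sub>C x = 0" by (rule add_right_imp_eq)
  then show ?thesis using assms(1) norm_scaleC_ell2[of "a - b" x] by simp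
qed

lemma galg_char_add: "galg_char c (f + h) = galg_char c f + galg_char c (h :: 'g::group_add \<Rightarrow>\<^sub>0 complex)"
  (is "?l = ?r")
proof -
  obtain x :: "nat ell2" where "x \<noteq> 0" using ex_ell2_nonzero by blast
  then show ?thesis
    by (rule scaleC_cancel_right_ell2)
       (simp add: scaleC_add_left algebra_rep_add flip: algebra_rep_char)
qed

lemma galg_char_single: "galg_char c (Poly_Mapping.single g a) = a * c g"
  by (cases "a = 0") (simp_all add: galg_char_def)

lemma galg_char_zero: "galg_char c 0 = 0"
  by (simp add: galg_char_def)

lemma galg_char_sum:
  "galg_char c (\<Sum>i\<in>A. f i) = (\<Sum>i\<in>A. galg_char c (f i :: 'g::group_add \<Rightarrow>\<^sub>0 complex))"
  by (induction A rule: infinite_finite_induct) (simp_all add: galg_char_add galg_char_zero)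

lemma galg_char_diff:
  "galg_char c (f - h) = galg_char c f - galg_char c (h :: 'g::group_add \<Rightarrow>\<^sub>0 complex)"
  using galg_char_add[of c "f - h" h] by simp

context
  fixes c :: "'g::group_add \<Rightarrow> complex"
  assumes c_add: "\<And>g h. c (g + h) = c g * c h" and c_zero: "c 0 = 1" and c_norm: "\<And>g. cmod (c g) = 1"
begin

lemma unitary_rep_char: "unitary_rep (\<lambda>g. (*\<^sub>C) (c g) :: 'x ell2 \<Rightarrow> 'x ell2)"
  unfolding unitary_rep_def unitary_op_def
proof (intro conjI allI)
  fix g
  have "c g * cnj (c g) = 1" by (simp add: c_norm flip: complex_norm_square)
  then show "surj ((*\<^sub>C) (c g) :: 'x ell2 \<Rightarrow> 'x ell2)"
    by (intro surjI[of _ "(*\<^sub>C) (cnj (c g))"]) (simp add: scaleC_scaleC)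
qed (auto simp: scaleC_add_right scaleC_scaleC mult.commute norm_scaleC_ell2 c_norm c_zero c_add)

lemma galg_char_mult: "galg_char c (f * h) = galg_char c f * galg_char c h"
proof -
  obtain x :: "nat ell2" where "x \<noteq> 0" using ex_ell2_nonzero by blast
  then show ?thesis
    by (rule scaleC_cancel_right_ell2)
       (simp add: algebra_rep_mult[OF unitary_rep_char] flip: algebra_rep_char scaleC_scaleC)
qed

lemma galg_char_one: "galg_char c 1 = 1"
  by (simp add: galg_char_single c_zero flip: single_one)

text \<open>Both \<open>c (- g)\<close> and \<open>cnj (c g)\<close> are inverses of
  \<open>c g\<close>, the latter because \<open>c g\<close> has modulus 1.\<close>

lemma galg_char_star: "galg_char c (galg_star f) = cnj (galg_char c f)"
proof (induction f rule: galg_induct)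
  case (single g a)
  have "c (- g) * c g = 1" by (simp add: c_zero flip: c_add)
  moreover have "cnj (c g) * c g = 1" by (simp add: c_norm mult.commute[of "cnj _"] flip: complex_norm_square)
  ultimately have "c (- g) = cnj (c g)" using c_norm[of g] by (metis mult_cancel_right mult_zero_right zero_neq_one)
  then show ?case by (simp add: galg_star_single galg_char_single)
qed (simp_all add: galg_star_add galg_char_add galg_char_zero)

text \<open>The scalar action of \<open>c\<close> on the space used in \<open>full_norm\<close> is
  one of the representations in that supremum.\<close>

lemma norm_galg_char_le: "cmod (galg_char c f) \<le> full_norm f"
proof -
  obtain x :: "('g \<times> nat) ell2" where "x \<noteq> 0" using ex_ell2_nonzero by blast
  then show ?thesis
    using algebra_rep_le_full_norm[OF unitary_rep_char, of f x]
    by (simp add: algebra_rep_char norm_scaleC_ell2)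
qed

end

section \<open>The group algebra inside its completion\<close>

lemma of_galg_add: "of_galg (f + h) = of_galg f + of_galg h"
  unfolding of_galg_def
  by (subst plus_full_cstar.abs_eq) (simp_all add: full_cauchy_rel_refl full_cauchy_const)

lemma of_galg_mult: "of_galg (f * h) = of_galg f * of_galg h"
  unfolding of_galg_def
  by (subst times_full_cstar.abs_eq) (simp_all add: full_cauchy_rel_refl full_cauchy_const)

lemma of_galg_scale: "of_galg (galg_scale a f) = a *\<^sub>C of_galg f"
  unfolding of_galg_def
  by (subst scaleC_full_cstar.abs_eq) (simp_all add: full_cauchy_rel_refl full_cauchy_const)

lemma of_galg_star: "of_galg (galg_star f) = star (of_galg f)"
  unfolding of_galg_def
  by (subst star_full_cstar.abs_eq) (simp_all add: full_cauchy_rel_refl full_cauchy_const)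

lemma of_galg_one: "of_galg 1 = 1"
  by (simp add: of_galg_def one_full_cstar_def)

lemma of_galg_zero: "of_galg 0 = 0"
  by (simp add: of_galg_def zero_full_cstar_def)

lemma of_galg_sum: "of_galg (\<Sum>i\<in>A. f i) = (\<Sum>i\<in>A. of_galg (f i))"
  by (induction A rule: infinite_finite_induct) (simp_all add: of_galg_add of_galg_zero)

text \<open>The C*-identity and submultiplicativity give one inequality; applying it to
  \<open>star x\<close> gives the other.\<close>

lemma norm_star_full_cstar: "norm (star x) = norm (x :: 'g::group_add full_cstar)"
proof -
  have *: "norm y \<le> norm (star y)" for y :: "'g full_cstar"
    using norm_star_mult[of y] norm_mult_ineq[of "star y" y]
    by (cases "y = 0") (simp_all add: power2_eq_square)
  show ?thesis using *[of x] *[of "star x"] by (simp add: star_star)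
qed

text \<open>Averaging an approximant with its adjoint makes it self-adjoint without increasing the
  error, since \<open>star\<close> is isometric and fixes \<open>x\<close>.\<close>

lemma selfadjoint_of_galg_dense:
  assumes "selfadjoint x" "e > 0"
  obtains f where "galg_star f = f" "norm (x - of_galg f) < e"
proof -
  obtain f where f: "norm (x - of_galg f) < e" using of_galg_dense[OF assms(2)] by blast
  define h where "h = galg_scale (1/2) (f + galg_star f)"
  have "star (x - of_galg f) + star (of_galg f) = x"
    using assms(1) by (simp add: selfadjoint_def flip: star_add)
  then have "x + x - of_galg (f + galg_star f) = (x - of_galg f) + star (x - of_galg f)"
    by (simp add: of_galg_add of_galg_star algebra_simps)
  then have "norm (x + x - of_galg (f + galg_star f)) \<le> 2 * norm (x - of_galg f)"
    by (metis norm_triangle_ineq norm_star_full_cstar mult_2)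
  moreover have "of_galg h = (1/2) *\<^sub>R of_galg (f + galg_star f)"
    by (simp add: h_def of_galg_scale scaleR_scaleC)
  then have "x - of_galg h = (1/2) *\<^sub>R (x + x - of_galg (f + galg_star f))"
    by (simp only: scaleR_diff_right scaleR_half_double)
  ultimately have "norm (x - of_galg h) < e" using f by simp
  moreover have "galg_star h = h"
    by (simp add: h_def galg_star_scale galg_star_add add.commute)
  ultimately show thesis using that by blast
qed

section \<open>Real parts of the generators and small characters\<close>

text \<open>Finite support allows the word-by-word bounds to be summed, so the Lipschitz constant
  depends on \<open>f\<close> alone.\<close>

lemma galg_char_free_lipschitz:
  assumes "\<forall>i. cmod (u i) = 1" "\<forall>i. cmod (v i) = 1" "\<forall>i. cmod (u i - v i) \<le> d"
  shows "cmod (galg_char (free_char u) f - galg_char (free_char v) f)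
    \<le> (\<Sum>g\<in>Poly_Mapping.keys f. cmod (Poly_Mapping.lookup f g) * real (word_length g)) * d"
  unfolding galg_char_def sum_subtractf[symmetric] sum_distrib_right
proof (rule sum_norm_le)
  fix g
  show "cmod (Poly_Mapping.lookup f g * free_char u g - Poly_Mapping.lookup f g * free_char v g)
      \<le> cmod (Poly_Mapping.lookup f g) * real (word_length g) * d"
    using mult_left_mono[OF free_char_lipschitz[OF assms, of g], of "cmod (Poly_Mapping.lookup f g)"]
    by (simp add: norm_mult mult.assoc flip: right_diff_distrib)
qed

definition generator_real_part :: "'i \<Rightarrow> 'i free_group \<Rightarrow>\<^sub>0 complex" where
  "generator_real_part i =
    Poly_Mapping.single (free_generator i) (1/2) + Poly_Mapping.single (- free_generator i) (1/2)"

lemma galg_star_generator_real_part: "galg_star (generator_real_part i) = generator_real_part i"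
  by (simp add: generator_real_part_def galg_star_add galg_star_single add.commute)

lemma galg_char_generator_real_part:
  assumes u: "\<forall>i. cmod (u i) = 1"
  shows "galg_char (free_char u) (generator_real_part i) = Re (u i)"
proof -
  note char = free_char_add[OF u] free_char_zero[OF u] norm_free_char[OF u]
  let ?f = "Poly_Mapping.single (free_generator i) (1/2 :: complex)"
  have "generator_real_part i = ?f + galg_star ?f"
    by (simp add: generator_real_part_def galg_star_single)
  then show ?thesis
    by (simp add: galg_char_add galg_char_star[OF char] galg_char_single free_char_generator
        complex_eq_iff)
qed

text \<open>On the half circles \<open>cis (pi * t j)\<close> the character value of
  \<open>F i\<close> differs from \<open>cos (pi * t i)\<close> by less than 1, as characters are
  contractive. It is thus positive at \<open>t i = 0\<close>, negative at \<open>t i = 1\<close> and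
  Lipschitz in \<open>t\<close>, so Poincare--Miranda applies.\<close>

lemma small_character:
  fixes F :: "nat \<Rightarrow> nat free_group \<Rightarrow>\<^sub>0 complex"
  assumes F: "\<And>i. i < n \<Longrightarrow> galg_star (F i) = F i"
    and close: "\<And>i. i < n \<Longrightarrow> full_norm (generator_real_part i - F i) < 1"
    and "0 < \<delta>"
  obtains u where "\<forall>i. cmod (u i) = 1" "\<forall>i<n. cmod (galg_char (free_char u) (F i)) \<le> \<delta>"
proof -
  define u where "u t j = cis (pi * t j)" for t :: "nat \<Rightarrow> real" and j :: nat
  define K where "K i = (\<Sum>g\<in>Poly_Mapping.keys (F i).
    cmod (Poly_Mapping.lookup (F i) g) * real (word_length g))" for i
  have u: "\<forall>j. cmod (u t j) = 1" for t by (simp add: u_def)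
  note char = free_char_add[OF u] free_char_zero[OF u] norm_free_char[OF u]
  let ?\<phi> = "\<lambda>i t. Re (galg_char (free_char (u t)) (F i))"
  have near: "\<bar>cos (pi * t i) - ?\<phi> i t\<bar> < 1" if "i < n" for i t
  proof -
    have "\<bar>cos (pi * t i) - ?\<phi> i t\<bar> = \<bar>Re (galg_char (free_char (u t)) (generator_real_part i - F i))\<bar>"
      by (simp add: galg_char_diff galg_char_generator_real_part[OF u]) (simp add: u_def)
    also have "\<dots> \<le> full_norm (generator_real_part i - F i)"
      using abs_Re_le_cmod norm_galg_char_le[OF char] by (rule order_trans)
    finally show ?thesis using close[OF that] by simp
  qed
  obtain t where "\<forall>i<n. \<bar>?\<phi> i t\<bar> \<le> \<delta>"
  \<comment> \<open>The sum of the \<open>K i\<close> serves as a common constant for all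
    \<open>i < n\<close>; the factor \<open>pi\<close> is the speed of
    \<open>cis (pi * t)\<close>.\<close>
  proof (rule approximate_Poincare_Miranda[of n ?\<phi> "(\<Sum>i<n. K i) * pi" \<delta>])
    fix i and t :: "nat \<Rightarrow> real" assume "i < n"
    show "0 < ?\<phi> i t" if "t i = 0" using near[OF \<open>i < n\<close>, of t] that by simp
    show "?\<phi> i t < 0" if "t i = 1" using near[OF \<open>i < n\<close>, of t] that by simp
  next
    fix i d and t t' :: "nat \<Rightarrow> real" assume "i < n" and d: "\<forall>j. \<bar>t j - t' j\<bar> \<le> d"
    have "0 \<le> d" using d[rule_format, of 0] by linarith
    have "cmod (u t j - u t' j) \<le> pi * d" for j
    proof -
      have "cmod (u t j - u t' j) \<le> \<bar>pi * t j - pi * t' j\<bar>"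
        unfolding u_def by (rule norm_cis_diff_le)
      also have "\<dots> = pi * \<bar>t j - t' j\<bar>"
        by (simp add: abs_mult flip: right_diff_distrib)
      also have "\<dots> \<le> pi * d" using d by simp
      finally show ?thesis .
    qed
    then have "cmod (galg_char (free_char (u t)) (F i) - galg_char (free_char (u t')) (F i)) \<le> K i * (pi * d)"
      unfolding K_def by (intro galg_char_free_lipschitz u) auto
    also have "\<dots> \<le> (\<Sum>i<n. K i) * (pi * d)"
      using \<open>i < n\<close> \<open>0 \<le> d\<close>
      by (intro mult_right_mono member_le_sum) (auto simp: K_def intro: sum_nonneg)
    finally show "\<bar>?\<phi> i t - ?\<phi> i t'\<bar> \<le> (\<Sum>i<n. K i) * pi * d"
      using abs_Re_le_cmod[of "galg_char (free_char (u t)) (F i) - galg_char (free_char (u t')) (F i)"]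
      by simp
  qed (use \<open>0 < \<delta>\<close> in auto)
  \<comment> \<open>Self-adjointness of \<open>F i\<close> makes its character value real, so
    control of the real part suffices.\<close>
  moreover have "cmod (galg_char (free_char (u t)) (F i)) = \<bar>?\<phi> i t\<bar>" if "i < n" for i
  proof -
    have "cnj (galg_char (free_char (u t)) (F i)) = galg_char (free_char (u t)) (F i)"
      using F[OF that] by (simp flip: galg_char_star[OF char])
    then show ?thesis by (simp add: cmod_eq_Re complex_cnj_cancel_iff complex_eq_iff)
  qed
  ultimately show thesis using that[of "u t"] u by simp
qed

section \<open>The obstruction to invertibility\<close>

text \<open>Approximate the \<open>y i\<close> and a left inverse \<open>z\<close> from the group
  algebra, so that the approximate product is within 1/2 of 1. Characters preserve this estimate,
  yet one of them is so small on the approximants of the \<open>y i\<close> that the product has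
  modulus at most 1/2.\<close>

lemma sum_squares_not_invertible:
  fixes y :: "nat \<Rightarrow> nat free_group full_cstar"
  assumes sa: "\<And>i. selfadjoint (y i)"
    and close: "\<And>i. norm (of_galg (generator_real_part i) - y i) < 1"
    and D: "finite D"
  shows "\<not> two_sided_invertible (\<Sum>i\<in>D. (y i)\<^sup>2)"
proof
  assume "two_sided_invertible (\<Sum>i\<in>D. (y i)\<^sup>2)"
  then obtain z where z: "z * (\<Sum>i\<in>D. (y i)\<^sup>2) = 1" by (auto simp: two_sided_invertible_def)
  \<comment> \<open>\<open>small_character\<close> speaks of initial segments, so \<open>D\<close>
    is enlarged to one.\<close>
  obtain n where n: "D \<subseteq> {..<n}" using D finite_nat_iff_bounded by blast
  have "\<exists>f. galg_star f = f \<and> norm (y i - of_galg f) < inverse (Suc k)" for i k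
    using selfadjoint_of_galg_dense[OF sa, of "inverse (Suc k)" i] by auto
  then obtain F where F: "\<And>i k. galg_star (F i k) = F i k"
      "\<And>i k. norm (y i - of_galg (F i k)) < inverse (Suc k)"
    by metis
  have "\<exists>f. norm (z - of_galg f) < inverse (Suc k)" for k
    using of_galg_dense[of "inverse (Suc k)" z] by auto
  then obtain W where W: "\<And>k. norm (z - of_galg (W k)) < inverse (Suc k)"
    by metis
  have lim: "(\<lambda>k. of_galg (X k)) \<longlonglongrightarrow> x" if "\<And>k. norm (x - of_galg (X k)) < inverse (Suc k)"
    for X and x :: "nat free_group full_cstar"
  proof (rule Lim_transform2[OF tendsto_const])
    show "(\<lambda>k. x - of_galg (X k)) \<longlonglongrightarrow> 0"
      by (rule Lim_null_comparison[OF _ LIMSEQ_inverse_real_of_nat])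
         (use that in \<open>auto intro: always_eventually less_imp_le\<close>)
  qed
  note F_lim = lim[OF F(2)] and W_lim = lim[OF W]
  have "(\<lambda>k. of_galg (W k) * (\<Sum>i\<in>D. (of_galg (F i k))\<^sup>2)) \<longlonglongrightarrow> z * (\<Sum>i\<in>D. (y i)\<^sup>2)"
    by (intro tendsto_intros F_lim W_lim)
  then have "(\<lambda>k. of_galg (W k * (\<Sum>i\<in>D. F i k * F i k))) \<longlonglongrightarrow> of_galg 1"
    unfolding z by (simp add: of_galg_mult of_galg_sum of_galg_one power2_eq_square)
  then have "\<forall>\<^sub>F k in sequentially. dist (of_galg (W k * (\<Sum>i\<in>D. F i k * F i k))) (of_galg 1) < 1/2"
    by (rule tendstoD) simp
  \<comment> \<open>The strict bound in \<open>close\<close> survives passage to good approximants,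
    and only finitely many indices are involved.\<close>
  moreover have "\<forall>\<^sub>F k in sequentially. \<forall>i\<in>{..<n}. full_norm (generator_real_part i - F i k) < 1"
  proof (rule eventually_ball_finite[OF finite_lessThan], rule ballI)
    fix i
    have "(\<lambda>k. norm (of_galg (generator_real_part i) - of_galg (F i k)))
        \<longlonglongrightarrow> norm (of_galg (generator_real_part i) - y i)"
      by (intro tendsto_intros F_lim)
    from order_tendstoD(2)[OF this close]
    show "\<forall>\<^sub>F k in sequentially. full_norm (generator_real_part i - F i k) < 1"
      by (simp add: norm_of_galg flip: of_galg_diff)
  qed
  ultimately obtain k where k: "dist (of_galg (W k * (\<Sum>i\<in>D. F i k * F i k))) (of_galg 1) < 1/2"
      "\<forall>i\<in>{..<n}. full_norm (generator_real_part i - F i k) < 1"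
    using eventually_happens'[OF sequentially_bot eventually_conj] by blast
  \<comment> \<open>With \<open>k\<close> now fixed, \<open>B\<close> is known before the character
    is chosen. The choice of \<open>\<delta>\<close> gives
    \<open>B * \<delta>\<^sup>2 = B / (2 * (B + 1))\<close>, which is at most 1/2; the added 1 keeps
    the denominator positive when \<open>B = 0\<close>.\<close>
  define B where "B = full_norm (W k) * real (card D)"
  have "0 \<le> B" by (simp add: B_def full_norm_nonneg)
  define \<delta> where "\<delta> = sqrt (1 / (2 * (B + 1)))"
  have "0 < \<delta>" using \<open>0 \<le> B\<close> by (simp add: \<delta>_def)
  then obtain u where u: "\<forall>i. cmod (u i) = 1"
    and small: "\<forall>i<n. cmod (galg_char (free_char u) (F i k)) \<le> \<delta>"
    using small_character[of n "\<lambda>i. F i k" \<delta>] F(1) k(2) by auto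
  note char = free_char_add[OF u] free_char_zero[OF u] norm_free_char[OF u]
  let ?\<chi> = "galg_char (free_char u)"
  have "cmod (\<Sum>i\<in>D. (?\<chi> (F i k))\<^sup>2) \<le> real (card D) * \<delta>\<^sup>2"
    using small n by (intro sum_norm_bound) (auto simp: norm_power intro!: power_mono)
  then have "cmod (?\<chi> (W k)) * cmod (\<Sum>i\<in>D. (?\<chi> (F i k))\<^sup>2) \<le> full_norm (W k) * (real (card D) * \<delta>\<^sup>2)"
    by (intro mult_mono norm_galg_char_le[OF char]) (simp_all add: full_norm_nonneg)
  also have "\<dots> = B * \<delta>\<^sup>2" by (simp add: B_def)
  also have "\<dots> \<le> 1/2"
    using \<open>0 \<le> B\<close> by (simp add: \<delta>_def field_simps)
  finally have "cmod (?\<chi> (W k) * (\<Sum>i\<in>D. (?\<chi> (F i k))\<^sup>2)) \<le> 1/2" by (simp add: norm_mult)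
  moreover have "cmod (?\<chi> (W k) * (\<Sum>i\<in>D. (?\<chi> (F i k))\<^sup>2) - 1) < 1/2"
  proof -
    have "?\<chi> (W k) * (\<Sum>i\<in>D. (?\<chi> (F i k))\<^sup>2) - 1 = ?\<chi> (W k * (\<Sum>i\<in>D. F i k * F i k) - 1)"
      by (simp add: galg_char_diff galg_char_sum galg_char_mult[OF char] galg_char_one[OF char]
          power2_eq_square)
    also have "cmod \<dots> \<le> full_norm (W k * (\<Sum>i\<in>D. F i k * F i k) - 1)"
      by (rule norm_galg_char_le[OF char])
    also have "\<dots> < 1/2"
      using k(1) by (simp add: dist_norm norm_of_galg flip: of_galg_diff)
    finally show ?thesis .
  qed
  ultimately show False
    using norm_triangle_ineq2[of 1 "?\<chi> (W k) * (\<Sum>i\<in>D. (?\<chi> (F i k))\<^sup>2)"]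
    by (simp add: norm_minus_commute)
qed

theorem corollary2p10:
  shows "strongly_infinite_real_rank TYPE(nat free_group full_cstar)"
  unfolding strongly_infinite_real_rank_def
proof
  let ?x = "\<lambda>i :: nat. of_galg (generator_real_part i)"
  assume "weakly_infinite_real_rank TYPE(nat free_group full_cstar)"
  moreover have "\<forall>i. selfadjoint (?x i)"
    by (simp add: selfadjoint_def galg_star_generator_real_part flip: of_galg_star)
  \<comment> \<open>The tolerance is 1, the distance from 0 of the values \<open>1\<close> and
    \<open>-1\<close> of the cosine on opposite faces.\<close>
  ultimately obtain y D where "\<forall>i. selfadjoint (y i)" "\<forall>i. norm (?x i - y i) < 1"
      "finite D" "two_sided_invertible (\<Sum>i\<in>D. (y i)\<^sup>2)"
    unfolding weakly_infinite_real_rank_def by (meson zero_less_one)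
  then show False using sum_squares_not_invertible by blast
qed

end
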